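(* Let $R$ be a Noetherian super-ring such that the Krull dimension $\mathrm{Kdim}(R_0)$ is finite, and let $I$ be any superideal of $R$. Then the super-rings $\mathsf{gr}_I(R)$ and $\mathsf{bgr}_I(R)$ are Noetherian. Moreover, $\mathrm{Ksdim}_0(\mathsf{gr}_I(R))<\infty$ and $\mathrm{Ksdim}_0(\mathsf{bgr}_I(R))<\infty$.
   Context: A super-ring is a unital associative $\mathbb{Z}_2$-graded ring $R=R_0\oplus R_1$; all super-rings are super-commutative, i.e. $ab=(-1)^{|a||b|}ba$ for homogeneous $a,b$ and $a^2=0$ for odd $a$. A superideal is a $\mathbb{Z}_2$-graded ideal $I=I_0\oplus I_1$. $R$ is Noetherian if it satisfies the ascending chain condition on superideals. For a super-ring $S$, $\mathrm{Ksdim}_0(S)=\mathrm{Kdim}(S_0)$ is the Krull dimension of the commutative ring $S_0$. For a superideal $I$ of $R$, $\mathsf{gr}_I(R)=\bigoplus_{n\ge 0} I^n/I^{n+1}$. Put $I_{k,l}=I_0^kI_1^lR$ for $k,l\ge 0$ (so $I_{0,0}=R$); then $I_{k,l}I_{k',l'}\subseteq I_{k+k',l+l'}$, and $\mathsf{bgr}_I(R)=\bigoplus_{k,l\ge 0} I_{k,l}/I\,I_{k,l}$, where $I\,I_{k,l}=I_{k+1,l}+I_{k,l+1}$. Both are super-rings with multiplication induced from $R$ and $\mathbb{Z}_2$-grading induced from $R$. *)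

theory Defs
  imports
    "HOL-Algebra.QuotRing"
    "HOL-Algebra.Ideal_Product"
    "HOL-Library.Extended_Real"
    "HOL-Library.Product_Plus"
begin

section \<open>Super-commutative super-rings\<close>

record 'a super_ring = "'a ring" +
  even_part :: "'a set"
  odd_part :: "'a set"

locale super_ring = ring R for R (structure) +
  assumes even_subgroup: "subgroup (even_part R) (add_monoid R)"
    and odd_subgroup: "subgroup (odd_part R) (add_monoid R)"
    and decomp: "carrier R = even_part R <+> odd_part R"
    and direct: "even_part R \<inter> odd_part R = {\<zero>}"
    and even_even: "\<lbrakk>a \<in> even_part R; b \<in> even_part R\<rbrakk> \<Longrightarrow> a \<otimes> b \<in> even_part R"
    and even_odd: "\<lbrakk>a \<in> even_part R; b \<in> odd_part R\<rbrakk> \<Longrightarrow> a \<otimes> b \<in> odd_part R"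
    and odd_even: "\<lbrakk>a \<in> odd_part R; b \<in> even_part R\<rbrakk> \<Longrightarrow> a \<otimes> b \<in> odd_part R"
    and odd_odd: "\<lbrakk>a \<in> odd_part R; b \<in> odd_part R\<rbrakk> \<Longrightarrow> a \<otimes> b \<in> even_part R"
    and even_commute:
      "\<lbrakk>a \<in> even_part R; b \<in> even_part R \<union> odd_part R\<rbrakk> \<Longrightarrow> a \<otimes> b = b \<otimes> a"
    and odd_anticommute:
      "\<lbrakk>a \<in> odd_part R; b \<in> odd_part R\<rbrakk> \<Longrightarrow> a \<otimes> b = \<ominus> (b \<otimes> a)"
    and odd_square: "a \<in> odd_part R \<Longrightarrow> a \<otimes> a = \<zero>"

locale superideal = ideal I R + super_ring R for I and R (structure) +
  assumes graded: "I = (I \<inter> even_part R) <+> (I \<inter> odd_part R)"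

locale noetherian_super_ring = super_ring R for R (structure) +
  assumes acc: "\<lbrakk>\<And>n::nat. superideal (J n) R; \<And>n. J n \<subseteq> J (Suc n)\<rbrakk>
    \<Longrightarrow> \<exists>N. \<forall>n\<ge>N. J n = J N"

definition even_subring :: "('a, 'm) super_ring_scheme \<Rightarrow> ('a, 'm) super_ring_scheme"
  where "even_subring R = R\<lparr>carrier := even_part R\<rparr>"


section \<open>Krull dimension\<close>

text \<open>The supremum is taken in the extended reals, so the zero ring, which has no prime ideal,
  has dimension \<open>-\<infinity>\<close>.\<close>

definition krull_dim :: "('a, 'm) ring_scheme \<Rightarrow> ereal"
  where "krull_dim A =
    (SUP n \<in> {n::nat. \<exists>P :: nat \<Rightarrow> 'a set.
        (\<forall>i\<le>n. primeideal (P i) A) \<and> (\<forall>i<n. P i \<subset> P (Suc i))}. ereal (real n))"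

definition ksdim0 :: "('a, 'm) super_ring_scheme \<Rightarrow> ereal"
  where "ksdim0 R = krull_dim (even_subring R)"


section \<open>Graded super-rings attached to a superideal\<close>

text \<open>Let \<open>F i\<close> and \<open>G i \<subseteq> F i\<close> be families of ideals with \<open>F i F j \<subseteq> F (i + j)\<close> and with
  \<open>F i G j\<close>, \<open>G i F j\<close> both contained in \<open>G (i + j)\<close>. The direct sum of the \<open>F i / G i\<close> is modelled by
  finitely supported families of cosets, the class of \<open>a \<in> F i\<close> being \<open>G i +> a\<close> and the
  zero of the \<open>i\<close>-th summand being \<open>G i\<close>. The elements of \<open>graded_sum R F G P\<close> are the families
  all of whose components are classes of elements of \<open>P\<close>.\<close>

definition graded_sum ::
  "('a, 'm) ring_scheme \<Rightarrow> ('i \<Rightarrow> 'a set) \<Rightarrow> ('i \<Rightarrow> 'a set) \<Rightarrow> 'a set \<Rightarrow> ('i \<Rightarrow> 'a set) set"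
  where "graded_sum R F G P =
    {f. (\<forall>i. \<exists>a \<in> F i \<inter> P. f i = G i +>\<^bsub>R\<^esub> a) \<and> finite {i. f i \<noteq> G i}}"

text \<open>The product of the classes of \<open>a \<in> F i\<close> and \<open>b \<in> F j\<close> is the class \<open>G (i + j) +> a \<otimes> b\<close>.
  It is written with \<^const>\<open>rcoset_mult\<close>, whose two arguments are here cosets of the
  different ideals \<open>G i\<close> and \<open>G j\<close>. Sums in \<open>F n / G n\<close> are computed in \<open>R Quot G n\<close>.\<close>

definition graded_super_ring ::
  "('a, 'm) super_ring_scheme \<Rightarrow> ('i::comm_monoid_add \<Rightarrow> 'a set) \<Rightarrow> ('i \<Rightarrow> 'a set)
    \<Rightarrow> ('i \<Rightarrow> 'a set) super_ring"
  where "graded_super_ring R F G =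
    \<lparr>carrier = graded_sum R F G (carrier R),
     mult = (\<lambda>f g n. finsum (R Quot G n)
               (\<lambda>(i, j). rcoset_mult R (G n) (f i) (g j)) {(i, j). i + j = n}),
     one = (\<lambda>n. if n = 0 then G 0 +>\<^bsub>R\<^esub> \<one>\<^bsub>R\<^esub> else G n),
     zero = G,
     add = (\<lambda>f g n. f n \<oplus>\<^bsub>R Quot G n\<^esub> g n),
     even_part = graded_sum R F G (even_part R),
     odd_part = graded_sum R F G (odd_part R)\<rparr>"

text \<open>The powers \<open>I^n\<close> are taken in the monoid of ideals, whose unit is \<open>carrier R\<close>.\<close>

definition gr :: "('a, 'm) super_ring_scheme \<Rightarrow> 'a set \<Rightarrow> (nat \<Rightarrow> 'a set) super_ring"
  where "gr R I = graded_super_ring R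
    (\<lambda>n. I [^]\<^bsub>ideals_set R\<^esub> n) (\<lambda>n. I [^]\<^bsub>ideals_set R\<^esub> Suc n)"

text \<open>\<^const>\<open>ideal_prod\<close> is the set of finite sums of products, which is meaningful also when its left
  argument is only an additive subgroup, such as \<open>I\<^sub>0\<close> and \<open>I\<^sub>1\<close> below; thus
  \<open>bipower R I k l\<close> is \<open>I\<^sub>0 \<cdots> I\<^sub>0 I\<^sub>1 \<cdots> I\<^sub>1 R\<close> with \<open>k\<close> factors \<open>I\<^sub>0\<close> and \<open>l\<close> factors \<open>I\<^sub>1\<close>.\<close>

definition bipower :: "('a, 'm) super_ring_scheme \<Rightarrow> 'a set \<Rightarrow> nat \<Rightarrow> nat \<Rightarrow> 'a set"
  where "bipower R I k l =
    (ideal_prod R (I \<inter> even_part R) ^^ k) ((ideal_prod R (I \<inter> odd_part R) ^^ l) (carrier R))"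

definition bgr :: "('a, 'm) super_ring_scheme \<Rightarrow> 'a set \<Rightarrow> (nat \<times> nat \<Rightarrow> 'a set) super_ring"
  where "bgr R I = graded_super_ring R
    (\<lambda>(k, l). bipower R I k l) (\<lambda>(k, l). I \<cdot>\<^bsub>R\<^esub> bipower R I k l)"

end

theory Submission
  imports Defs
begin

text \<open>Both graded super-rings are generated over their component of degree \<open>0\<close>, a quotient of \<open>R\<close>, by
  the classes of finitely many homogeneous generators of \<open>I\<close> (respectively of \<open>I\<^sub>0 R\<close> and
  \<open>I\<^sub>1 R\<close>). It therefore suffices to see that being Noetherian with an even part of finite
  Krull dimension passes to homomorphic images and to \<open>A[z]\<close> for homogeneous \<open>z\<close>. For the
  Noetherian property this is Hilbert's argument with leading coefficients. For the dimension, an even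
  \<open>z\<close> raises \<open>d\<close> to at most \<open>2d + 1\<close>, because three primes \<open>P\<^sub>0 \<subset> P\<^sub>1 \<subset> P\<^sub>2\<close> never have the
  same contraction, while an odd \<open>z\<close> enlarges the even part by elements of square zero only, which lie in
  every prime.\<close>


section \<open>Sub-super-rings and graded ideals\<close>

text \<open>All rings to which elements are adjoined lie in one ambient super-ring and are given by
  their carriers: subsets closed under the operations and under the projection to the even part.
  Repeated adjunction then stays in one type, and ideals of nested rings can be compared as sets.
  The price is that A[z] is spanned by the powers of z without being free over A. A value does not
  determine its expression sum a_i z^i, so elements have neither a degree nor a leading coefficient;
  Hilbert's argument and the division behind the dimension bound are run on expressions with an
  explicit bound on the exponents. The bound 2d + 1 is the classical one for a polynomial ring over
  a commutative ring: the primes over a fixed prime p correspond to primes of a quotient of K[z],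
  where K is the field of fractions modulo p, and K[z] has dimension 1. A chain therefore meets each
  fibre at most twice, and every second prime of it has a new contraction. In the direct sums,
  computations are made with families of representatives in R, where the product is a convolution;
  cosets enter only through well-definedness and finite support.\<close>

lemma additive_subgroup_alt:
  assumes "ring R"
  shows "additive_subgroup X R \<longleftrightarrow> X \<subseteq> carrier R \<and> \<zero>\<^bsub>R\<^esub> \<in> X \<and> (\<forall>a\<in>X. \<forall>b\<in>X. a \<oplus>\<^bsub>R\<^esub> b \<in> X)
    \<and> (\<forall>a\<in>X. \<ominus>\<^bsub>R\<^esub> a \<in> X)"
proof -
  interpret ring R by fact
  have "subgroup X (add_monoid R) \<longleftrightarrow> X \<subseteq> carrier R \<and> \<zero>\<^bsub>R\<^esub> \<in> X \<and> (\<forall>a\<in>X. \<forall>b\<in>X. a \<oplus>\<^bsub>R\<^esub> b \<in> X)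
    \<and> (\<forall>a\<in>X. \<ominus>\<^bsub>R\<^esub> a \<in> X)"
    by (auto simp: subgroup_def a_inv_def)
  then show ?thesis
    by (simp add: additive_subgroup_def)
qed

context super_ring
begin

lemma additive_subgroup_closedI:
  assumes "X \<subseteq> carrier R" "\<zero> \<in> X" "\<And>a b. a \<in> X \<Longrightarrow> b \<in> X \<Longrightarrow> a \<oplus> b \<in> X"
    "\<And>a. a \<in> X \<Longrightarrow> \<ominus> a \<in> X"
  shows "additive_subgroup X R"
  using assms by (simp add: additive_subgroup_alt[OF ring_axioms])

lemma
  assumes "additive_subgroup X R"
  shows asub_carr: "a \<in> X \<Longrightarrow> a \<in> carrier R"
    and asub_zero: "\<zero> \<in> X"
    and asub_add: "\<lbrakk>a \<in> X; b \<in> X\<rbrakk> \<Longrightarrow> a \<oplus> b \<in> X"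
    and asub_neg: "a \<in> X \<Longrightarrow> \<ominus> a \<in> X"
    and asub_diff: "\<lbrakk>a \<in> X; b \<in> X\<rbrakk> \<Longrightarrow> a \<ominus> b \<in> X"
  using assms by (auto simp: additive_subgroup_alt[OF ring_axioms] minus_eq)

lemma asub_cancel:
  assumes "additive_subgroup X R" "a \<in> carrier R" "b \<in> X" "a \<oplus> b \<in> X"
  shows "a \<in> X"
proof -
  have "b \<in> carrier R" using assms asub_carr by blast
  then have "a = (a \<oplus> b) \<ominus> b" using assms(2) by algebra
  then show ?thesis using asub_diff[OF assms(1,4,3)] by simp
qed

section \<open>Even and odd components of an element\<close>

lemma even_asub: "additive_subgroup (even_part R) R"
  and odd_asub: "additive_subgroup (odd_part R) R"
  by (simp_all add: additive_subgroup_def even_subgroup odd_subgroup)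

lemmas even_carr [simp] = asub_carr[OF even_asub]
  and odd_carr [simp] = asub_carr[OF odd_asub]

text \<open>With this projection an additive subgroup is graded as soon as it is closed under
  \<open>ev\<close>: closure under \<open>od\<close> follows by subtraction.\<close>

definition ev :: "'a \<Rightarrow> 'a"
  where "ev x = (THE e. e \<in> even_part R \<and> x \<ominus> e \<in> odd_part R)"

definition od :: "'a \<Rightarrow> 'a"
  where "od x = x \<ominus> ev x"

lemma even_odd_unique:
  assumes "e \<in> even_part R" "u \<in> odd_part R" "e' \<in> even_part R" "u' \<in> odd_part R"
    and "e \<oplus> u = e' \<oplus> u'"
  shows "e = e'" "u = u'"
proof -
  have c [simp]: "e \<in> carrier R" "u \<in> carrier R" "e' \<in> carrier R" "u' \<in> carrier R"
    using assms by simp_all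
  have "e \<ominus> e' = (e \<oplus> u) \<ominus> (e' \<oplus> u)" using c by algebra
  also have "\<dots> = u' \<ominus> u" unfolding assms(5) using c by algebra
  finally have *: "e \<ominus> e' = u' \<ominus> u" .
  have "e \<ominus> e' \<in> even_part R" "u' \<ominus> u \<in> odd_part R"
    using assms asub_diff even_asub odd_asub by blast+
  then have "e \<ominus> e' = \<zero>" using direct * by auto
  then show "e = e'" using minus_equality[of e "\<ominus> e'"] c by (simp add: minus_eq)
  then show "u = u'" using assms(5) by simp
qed

lemma ev_od_sum:
  assumes "e \<in> even_part R" "u \<in> odd_part R"
  shows "ev (e \<oplus> u) = e" "od (e \<oplus> u) = u"
proof -
  have c [simp]: "e \<in> carrier R" "u \<in> carrier R" using assms by simp_all
  have d: "e \<oplus> u \<ominus> e = u" using c by algebra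
  show 1: "ev (e \<oplus> u) = e" unfolding ev_def
  proof (rule the_equality)
    show "e \<in> even_part R \<and> e \<oplus> u \<ominus> e \<in> odd_part R" using assms d by simp
    fix e' assume e': "e' \<in> even_part R \<and> e \<oplus> u \<ominus> e' \<in> odd_part R"
    then have [simp]: "e' \<in> carrier R" by simp
    have "e \<oplus> u = e' \<oplus> (e \<oplus> u \<ominus> e')" using c \<open>e' \<in> carrier R\<close> by algebra
    then show "e' = e" using even_odd_unique(1)[OF assms, of e'] e' by metis
  qed
  show "od (e \<oplus> u) = u" unfolding od_def 1 using d .
qed

lemma ex_decomp: "x \<in> carrier R \<Longrightarrow> \<exists>e\<in>even_part R. \<exists>u\<in>odd_part R. x = e \<oplus> u"
  using decomp by (auto simp: set_add_def')

lemma ev_even [simp]: "x \<in> carrier R \<Longrightarrow> ev x \<in> even_part R"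
  and od_odd [simp]: "x \<in> carrier R \<Longrightarrow> od x \<in> odd_part R"
  and ev_od: "x \<in> carrier R \<Longrightarrow> ev x \<oplus> od x = x"
  using ex_decomp[of x] by (auto simp: ev_od_sum)

lemma even_zero [simp]: "\<zero> \<in> even_part R" and odd_zero [simp]: "\<zero> \<in> odd_part R"
  by (rule asub_zero[OF even_asub], rule asub_zero[OF odd_asub])

lemma ev_id: "x \<in> even_part R \<Longrightarrow> ev x = x"
  and od_0: "x \<in> even_part R \<Longrightarrow> od x = \<zero>"
  using ev_od_sum[of x \<zero>] by simp_all

lemma ev_0: "x \<in> odd_part R \<Longrightarrow> ev x = \<zero>"
  using ev_od_sum(1)[of \<zero> x] by simp

lemma ev_add: "\<lbrakk>x \<in> carrier R; y \<in> carrier R\<rbrakk> \<Longrightarrow> ev (x \<oplus> y) = ev x \<oplus> ev y"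
  and od_add: "\<lbrakk>x \<in> carrier R; y \<in> carrier R\<rbrakk> \<Longrightarrow> od (x \<oplus> y) = od x \<oplus> od y"
proof -
  assume [simp]: "x \<in> carrier R" "y \<in> carrier R"
  have "x \<oplus> y = (ev x \<oplus> od x) \<oplus> (ev y \<oplus> od y)" by (simp add: ev_od)
  also have "\<dots> = (ev x \<oplus> ev y) \<oplus> (od x \<oplus> od y)"
    by (simp add: a_ac)
  finally have e: "x \<oplus> y = \<dots>" .
  have "ev x \<oplus> ev y \<in> even_part R" "od x \<oplus> od y \<in> odd_part R"
    using asub_add even_asub odd_asub by simp_all
  then show "ev (x \<oplus> y) = ev x \<oplus> ev y" "od (x \<oplus> y) = od x \<oplus> od y"
    unfolding e using ev_od_sum by simp_all
qed

lemma ev_mult_even: "\<lbrakk>x \<in> carrier R; z \<in> even_part R\<rbrakk> \<Longrightarrow> ev (x \<otimes> z) = ev x \<otimes> z"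
  and ev_mult_odd: "\<lbrakk>x \<in> carrier R; y \<in> odd_part R\<rbrakk> \<Longrightarrow> ev (x \<otimes> y) = od x \<otimes> y"
  and od_mult_odd: "\<lbrakk>x \<in> carrier R; y \<in> odd_part R\<rbrakk> \<Longrightarrow> od (x \<otimes> y) = ev x \<otimes> y"
proof -
  assume [simp]: "x \<in> carrier R"
  have *: "x \<otimes> z = ev x \<otimes> z \<oplus> od x \<otimes> z" if [simp]: "z \<in> carrier R" for z
    using l_distr[of "ev x" "od x" z] by (simp add: ev_od)
  show "ev (x \<otimes> z) = ev x \<otimes> z" if "z \<in> even_part R"
    using that *[of z] ev_od_sum[of "ev x \<otimes> z" "od x \<otimes> z"] even_even odd_even by simp_all
  show "ev (x \<otimes> y) = od x \<otimes> y" "od (x \<otimes> y) = ev x \<otimes> y" if "y \<in> odd_part R"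
    using that *[of y] ev_od_sum[of "od x \<otimes> y" "ev x \<otimes> y"] even_odd odd_odd 
    by (simp_all add: a_comm)
qed

text \<open>For homogeneous y, the components of y = y \<open>ev \<one>\<close> + y
  \<open>od \<one>\<close> have opposite parities, so the one of the wrong parity, y
  \<open>od \<one>\<close>, is 0. Taking y to be \<open>ev \<one>\<close> and
  \<open>od \<one>\<close> gives \<open>od \<one>\<close> = 0.\<close>

lemma one_even [simp]: "\<one> \<in> even_part R"
proof -
  have e: "\<one> = ev \<one> \<oplus> od \<one>" by (simp add: ev_od)
  have *: "y \<otimes> od \<one> = \<zero>" if y: "y \<in> even_part R \<union> odd_part R" for y
  proof -
    have [simp]: "y \<in> carrier R" using y by auto
    have "y = y \<otimes> ev \<one> \<oplus> y \<otimes> od \<one>" using r_distr[of "ev \<one>" "od \<one>" y] e by simp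
    moreover have "y = y \<oplus> \<zero>" "y = \<zero> \<oplus> y" by simp_all
    ultimately show ?thesis using y even_odd_unique[of "y \<otimes> ev \<one>" "y \<otimes> od \<one>" y \<zero>]
        even_odd_unique[of "y \<otimes> od \<one>" "y \<otimes> ev \<one>" \<zero> y] even_even[of y "ev \<one>"]
        even_odd[of y "od \<one>"]  odd_even[of y "ev \<one>"] odd_odd[of y "od \<one>"]
      by (auto simp: a_comm)
  qed
  have "od \<one> = ev \<one> \<otimes> od \<one> \<oplus> od \<one> \<otimes> od \<one>"
    using l_distr[of "ev \<one>" "od \<one>" "od \<one>"] e by simp
  then have "od \<one> = \<zero>" by (simp add: *)
  then show ?thesis using e ev_even[of \<one>] by simp
qed

lemma homog_pow:
  assumes "z \<in> even_part R \<union> odd_part R"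
  shows "z [^] (n::nat) \<in> even_part R \<union> odd_part R"
proof (induction n)
  case (Suc n)
  then show ?case using assms even_even odd_even even_odd odd_odd by auto
qed simp

lemma even_pow:
  assumes "z \<in> even_part R"
  shows "z [^] (n::nat) \<in> even_part R"
proof (induction n)
  case (Suc n)
  then show ?case using assms even_even by auto
qed simp

definition subsuper_ring :: "'a set \<Rightarrow> bool"
  where "subsuper_ring A \<longleftrightarrow> additive_subgroup A R \<and> \<one> \<in> A \<and> (\<forall>a\<in>A. \<forall>b\<in>A. a \<otimes> b \<in> A)
    \<and> (\<forall>a\<in>A. ev a \<in> A)"

text \<open>Closure is required on the left only; for graded J and a sub-super-ring A,
  supercommutativity turns it into closure on both sides (\<open>graded_ideal_r\<close>).\<close>

definition graded_ideal :: "'a set \<Rightarrow> 'a set \<Rightarrow> bool"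
  where "graded_ideal A J \<longleftrightarrow> additive_subgroup J R \<and> J \<subseteq> A \<and> (\<forall>a\<in>A. \<forall>x\<in>J. a \<otimes> x \<in> J)
    \<and> (\<forall>x\<in>J. ev x \<in> J)"

definition graded_noetherian :: "'a set \<Rightarrow> bool"
  where "graded_noetherian A \<longleftrightarrow> (\<forall>J :: nat \<Rightarrow> 'a set. (\<forall>n. graded_ideal A (J n)) \<and> (\<forall>n. J n \<subseteq> J (Suc n))
    \<longrightarrow> (\<exists>N. \<forall>n\<ge>N. J n = J N))"

lemma graded_noetherianD:
  assumes "graded_noetherian A" "\<And>n::nat. graded_ideal A (J n)" "\<And>n. J n \<subseteq> J (Suc n)"
  shows "\<exists>N. \<forall>n\<ge>N. J n = J N"
  using assms unfolding graded_noetherian_def by simp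

lemma
  assumes "subsuper_ring A"
  shows subsuper_ring_asub: "additive_subgroup A R"
    and subsuper_ring_one: "\<one> \<in> A"
    and subsuper_ring_mult: "\<lbrakk>a \<in> A; b \<in> A\<rbrakk> \<Longrightarrow> a \<otimes> b \<in> A"
    and subsuper_ring_ev: "a \<in> A \<Longrightarrow> ev a \<in> A"
    and subsuper_ring_od: "a \<in> A \<Longrightarrow> od a \<in> A"
  using assms asub_diff asub_carr unfolding subsuper_ring_def od_def by blast+

lemma
  assumes "graded_ideal A J"
  shows graded_ideal_asub: "additive_subgroup J R"
    and graded_ideal_sub: "J \<subseteq> A"
    and graded_ideal_l: "\<lbrakk>a \<in> A; x \<in> J\<rbrakk> \<Longrightarrow> a \<otimes> x \<in> J"
    and graded_ideal_ev: "x \<in> J \<Longrightarrow> ev x \<in> J"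
    and graded_ideal_od: "x \<in> J \<Longrightarrow> od x \<in> J"
  using assms asub_diff asub_carr unfolding graded_ideal_def od_def by blast+

text \<open>Crossing z leaves the even component of a unchanged and alters the odd one at most by a
  sign, so a' is \<open>ev a\<close> plus or minus \<open>od a\<close>. Any graded additive subgroup
  contains it, so the lemma serves for subrings, ideals and the parity components of ideals
  alike.\<close>

lemma homog_twist:
  assumes A: "additive_subgroup A R" "\<And>a. a \<in> A \<Longrightarrow> ev a \<in> A" and z: "z \<in> even_part R \<union> odd_part R" and a: "a \<in> A"
  shows "\<exists>a'\<in>A. z \<otimes> a = a' \<otimes> z" "\<exists>a'\<in>A. a \<otimes> z = z \<otimes> a'"
proof -
  have od: "od a \<in> A" using A a asub_diff by (simp add: od_def)
  have [simp]: "a \<in> carrier R" "z \<in> carrier R" using a asub_carr[OF A(1)] z by auto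
  have zc: "z \<otimes> a = z \<otimes> ev a \<oplus> z \<otimes> od a" "a \<otimes> z = ev a \<otimes> z \<oplus> od a \<otimes> z"
    using r_distr[of "ev a" "od a" z] l_distr[of "ev a" "od a" z] by (simp_all add: ev_od)
  have 1: "z \<otimes> ev a = ev a \<otimes> z" using even_commute[of "ev a" z] z by simp
  consider "z \<otimes> od a = od a \<otimes> z" | "z \<otimes> od a = (\<ominus> od a) \<otimes> z"
    using z even_commute[of z "od a"] odd_anticommute[of z "od a"] by (auto simp: l_minus)
  then have "\<exists>s\<in>A. z \<otimes> od a = s \<otimes> z \<and> od a \<otimes> z = z \<otimes> s"
  proof cases
    case 2
    then have "od a \<otimes> z = z \<otimes> (\<ominus> od a)" by (simp add: l_minus r_minus)
    then show ?thesis using 2 asub_neg[OF A(1) od] by blast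
  qed (use od in auto)
  then obtain s where s: "s \<in> A" "z \<otimes> od a = s \<otimes> z" "od a \<otimes> z = z \<otimes> s" by blast
  then have [simp]: "s \<in> carrier R" using asub_carr A by blast
  have "ev a \<oplus> s \<in> A" using s A a asub_add by blast
  moreover have "z \<otimes> a = (ev a \<oplus> s) \<otimes> z" "a \<otimes> z = z \<otimes> (ev a \<oplus> s)"
    using zc s 1 by (simp_all add: l_distr r_distr)
  ultimately show "\<exists>a'\<in>A. z \<otimes> a = a' \<otimes> z" "\<exists>a'\<in>A. a \<otimes> z = z \<otimes> a'" by blast+
qed

lemma graded_ideal_r:
  assumes J: "graded_ideal A J" and A: "subsuper_ring A" and a: "a \<in> A" and x: "x \<in> J"
  shows "x \<otimes> a \<in> J"
proof -
  have hom: "x \<otimes> z \<in> J" if z: "z \<in> A" "z \<in> even_part R \<union> odd_part R" for z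
  proof -
    obtain x' where "x' \<in> J" "x \<otimes> z = z \<otimes> x'"
      using homog_twist(2)[OF graded_ideal_asub[OF J] graded_ideal_ev[OF J] z(2) x] by auto
    then show ?thesis using graded_ideal_l[OF J z(1)] by simp
  qed
  have [simp]: "a \<in> carrier R" "x \<in> carrier R"
    using a x asub_carr subsuper_ring_asub[OF A] graded_ideal_asub[OF J] by auto
  have "x \<otimes> a = x \<otimes> ev a \<oplus> x \<otimes> od a" using r_distr[of "ev a" "od a" x] by (simp add: ev_od)
  moreover have "x \<otimes> ev a \<in> J" "x \<otimes> od a \<in> J"
    using hom subsuper_ring_ev[OF A a] subsuper_ring_od[OF A a] by simp_all
  ultimately show ?thesis using asub_add[OF graded_ideal_asub[OF J]] by simp
qed

lemma subsuper_ring_carrier: "subsuper_ring (carrier R)"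
  unfolding subsuper_ring_def by (auto intro: additive_subgroup_closedI)

lemma superideal_iff: "superideal J R \<longleftrightarrow> graded_ideal (carrier R) J"
proof
  assume "superideal J R"
  then interpret J: superideal J R .
  have "ev x \<in> J" if x: "x \<in> J" for x
  proof -
    obtain e u where "e \<in> J \<inter> even_part R" "u \<in> J \<inter> odd_part R" "x = e \<oplus> u"
      using x by (subst (asm) J.graded) (auto simp: set_add_def')
    then show ?thesis using ev_od_sum(1)[of e u] by auto
  qed
  then show "graded_ideal (carrier R) J"
    unfolding graded_ideal_def using J.additive_subgroup_axioms J.I_l_closed J.a_subset by auto
next
  assume J: "graded_ideal (carrier R) J"
  have "ideal J R"
    by (rule idealI[OF ring_axioms])
      (use J graded_ideal_asub[OF J] graded_ideal_l graded_ideal_r subsuper_ring_carrier in \<open>auto simp: additive_subgroup_def\<close>)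
  moreover have "J = (J \<inter> even_part R) <+> (J \<inter> odd_part R)"
  proof
    show "J \<subseteq> (J \<inter> even_part R) <+> (J \<inter> odd_part R)"
    proof
      fix x assume x: "x \<in> J"
      then have "x \<in> carrier R" using J graded_ideal_asub asub_carr by blast
      then have "ev x \<in> J \<inter> even_part R" "od x \<in> J \<inter> odd_part R" "x = ev x \<oplus> od x"
        using x graded_ideal_ev[OF J] graded_ideal_od[OF J] by (simp_all add: ev_od)
      then show "x \<in> (J \<inter> even_part R) <+> (J \<inter> odd_part R)"
        unfolding set_add_def' by blast
    qed
    show "(J \<inter> even_part R) <+> (J \<inter> odd_part R) \<subseteq> J"
      using asub_add[OF graded_ideal_asub[OF J]] by (auto simp: set_add_def')
  qed
  ultimately show "superideal J R"
    by (simp add: superideal_def superideal_axioms_def super_ring_axioms)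
qed

lemma noetherian_iff: "noetherian_super_ring R \<longleftrightarrow> graded_noetherian (carrier R)"
  unfolding noetherian_super_ring_def noetherian_super_ring_axioms_def graded_noetherian_def superideal_iff
  by (auto simp: super_ring_axioms)

end


section \<open>Adjoining a homogeneous element: the basis theorem\<close>

text \<open>The diagonal chain stabilizes at some N, which by monotonicity settles all rows d \<ge>
  N simultaneously; the finitely many rows below N are chains of their own and stabilize one by
  one.\<close>

lemma double_chain_stabilizes:
  fixes L :: "nat \<Rightarrow> nat \<Rightarrow> 'b set"
  assumes mono1: "\<And>d n. L d n \<subseteq> L (Suc d) n" and mono2: "\<And>d n. L d n \<subseteq> L d (Suc n)"
    and Q: "\<And>d n. Q (L d n)"
    and acc: "\<And>J :: nat \<Rightarrow> 'b set. \<lbrakk>\<And>n. Q (J n); \<And>n. J n \<subseteq> J (Suc n)\<rbrakk> \<Longrightarrow> \<exists>N. \<forall>n\<ge>N. J n = J N"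
  shows "\<exists>N. \<forall>n\<ge>N. \<forall>d. L d n = L d N"
proof -
  have m1: "L d n \<subseteq> L d' n" if "d \<le> d'" for d d' n
    using that mono1 by (rule lift_Suc_mono_le[where f = "\<lambda>d. L d n", rotated])
  have m2: "L d n \<subseteq> L d n'" if "n \<le> n'" for d n n'
    using that mono2 by (rule lift_Suc_mono_le[where f = "\<lambda>n. L d n", rotated])
  have "\<exists>N. \<forall>n\<ge>N. L n n = L N N"
    by (rule acc) (use Q mono1 mono2 in blast)+
  then obtain N where N: "\<And>n. n \<ge> N \<Longrightarrow> L n n = L N N" by blast
  have "\<forall>d. \<exists>M. \<forall>n\<ge>M. L d n = L d M"
    by (intro allI acc) (use Q mono2 in blast)+
  then obtain M where M: "\<And>d n. n \<ge> M d \<Longrightarrow> L d n = L d (M d)" by metis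
  \<comment> \<open>\<open>K\<close> lies beyond the diagonal threshold and beyond the thresholds of
    the rows below \<open>N\<close>.\<close>
  define K where "K = Max (insert N (M ` {..<N}))"
  have K: "K \<ge> N" "\<And>d. d < N \<Longrightarrow> K \<ge> M d" unfolding K_def by auto
  have "L d n = L d K" if n: "n \<ge> K" for n d
  proof (cases "d < N")
    case True
    then show ?thesis using M[of d n] M[of d K] K n by (metis le_trans)
  next
    case False
    \<comment> \<open>Here d \<ge> N, so \<open>L d n\<close> is squeezed between
      \<open>L N N\<close> and a later diagonal member, which equals \<open>L N N\<close>.\<close>
    have big: "L d n = L N N" if "n \<ge> N" for n
      using N[of "max d n"] m1[of d "max d n" n] m2[of n "max d n" "max d n"]
        m1[of N d n] m2[of N n N] False that by fastforce
    show ?thesis using big[of n] big[of K] K n by simp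
  qed
  then show ?thesis by blast
qed

section \<open>Polynomial expressions in one homogeneous element\<close>

context super_ring
begin

text \<open>The values of expressions in z with exponents strictly below d; the index plays the role
  of a degree bound, with d = 0 reserved for the zero expression.\<close>

primrec polys :: "'a set \<Rightarrow> 'a \<Rightarrow> nat \<Rightarrow> 'a set"
  where "polys A z 0 = {\<zero>}"
  | "polys A z (Suc d) = {v \<oplus> a \<otimes> z [^] d | v a. v \<in> polys A z d \<and> a \<in> A}"

definition adj :: "'a set \<Rightarrow> 'a \<Rightarrow> 'a set"
  where "adj A z = (\<Union>d. polys A z d)"

context
  fixes A z
  assumes A: "subsuper_ring A" and z: "z \<in> even_part R \<union> odd_part R"
begin

lemma gen_carr [simp]: "z \<in> carrier R"
  using z by auto

lemma base_carr [simp]: "a \<in> A \<Longrightarrow> a \<in> carrier R"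
  using asub_carr subsuper_ring_asub[OF A] by blast

lemma base_asub: "additive_subgroup A R"
  by (rule subsuper_ring_asub[OF A])

lemmas base_add = asub_add[OF base_asub] and base_neg = asub_neg[OF base_asub] and base_zero = asub_zero[OF base_asub]
  and base_mult = subsuper_ring_mult[OF A] and base_one = subsuper_ring_one[OF A]

lemma polys_carr: "v \<in> polys A z d \<Longrightarrow> v \<in> carrier R"
  by (induction d arbitrary: v) auto

lemma polys_SucI: "\<lbrakk>v \<in> polys A z d; a \<in> A\<rbrakk> \<Longrightarrow> v \<oplus> a \<otimes> z [^] d \<in> polys A z (Suc d)"
  by auto

lemma polys_asub: "additive_subgroup (polys A z d) R"
proof (rule additive_subgroup_closedI)
  show "polys A z d \<subseteq> carrier R" using polys_carr by blast
  show "\<zero> \<in> polys A z d"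
  proof (induction d)
    case (Suc d)
    show ?case using polys_SucI[OF Suc base_zero] by simp
  qed simp
  show "a \<oplus> b \<in> polys A z d" if "a \<in> polys A z d" "b \<in> polys A z d" for a b
    using that
  proof (induction d arbitrary: a b)
    case (Suc d)
    then obtain v w s t where *: "v \<in> polys A z d" "w \<in> polys A z d" "s \<in> A" "t \<in> A"
      "a = v \<oplus> s \<otimes> z [^] d" "b = w \<oplus> t \<otimes> z [^] d" by auto
    have [simp]: "v \<in> carrier R" "w \<in> carrier R" using * polys_carr by auto
    have "a \<oplus> b = (v \<oplus> w) \<oplus> (s \<oplus> t) \<otimes> z [^] d"
      using * by (simp add: l_distr a_ac)
    then show ?case using polys_SucI[OF Suc.IH[OF *(1,2)] base_add[OF *(3,4)]] by simp
  qed simp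
  show "\<ominus> a \<in> polys A z d" if "a \<in> polys A z d" for a
    using that
  proof (induction d arbitrary: a)
    case (Suc d)
    then obtain v s where *: "v \<in> polys A z d" "s \<in> A" "a = v \<oplus> s \<otimes> z [^] d" by auto
    have [simp]: "v \<in> carrier R" using * polys_carr by auto
    have "\<ominus> a = \<ominus> v \<oplus> (\<ominus> s) \<otimes> z [^] d" using * by (simp add: l_minus minus_add)
    then show ?case using polys_SucI[OF Suc.IH[OF *(1)] base_neg[OF *(2)]] by simp
  qed simp
qed

lemmas polys_add = asub_add[OF polys_asub] and polys_zero = asub_zero[OF polys_asub]
  and polys_neg = asub_neg[OF polys_asub] and polys_diff = asub_diff[OF polys_asub]

lemma polys_mono: "d \<le> e \<Longrightarrow> polys A z d \<subseteq> polys A z e"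
proof (rule lift_Suc_mono_le[of "polys A z"])
  show "polys A z d \<subseteq> polys A z (Suc d)" for d
  proof
    fix v assume v: "v \<in> polys A z d"
    show "v \<in> polys A z (Suc d)"
      using polys_SucI[OF v base_zero] polys_carr[OF v] by simp
  qed
qed

lemma polys_monom: "\<lbrakk>a \<in> A; i < d\<rbrakk> \<Longrightarrow> a \<otimes> z [^] i \<in> polys A z d"
  using polys_SucI[OF polys_zero, of a i] polys_mono[of "Suc i" d] by auto

lemma polys_l: "\<lbrakk>a \<in> A; v \<in> polys A z d\<rbrakk> \<Longrightarrow> a \<otimes> v \<in> polys A z d"
proof (induction d arbitrary: v)
  case (Suc d)
  then obtain w s where *: "w \<in> polys A z d" "s \<in> A" "v = w \<oplus> s \<otimes> z [^] d" by auto
  have "a \<otimes> v = a \<otimes> w \<oplus> (a \<otimes> s) \<otimes> z [^] d"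
    using * Suc.prems(1) polys_carr by (simp add: r_distr m_assoc)
  then show ?case using polys_SucI[OF Suc.IH[OF Suc.prems(1) *(1)] base_mult[OF Suc.prems(1) *(2)]]
    by simp
qed simp

lemma pow_twist: "a \<in> A \<Longrightarrow> \<exists>a'\<in>A. z [^] (d::nat) \<otimes> a = a' \<otimes> z [^] d"
  using homog_twist(1)[OF base_asub subsuper_ring_ev[OF A] homog_pow[OF z]] .

text \<open>Moving a to the left across z^d only replaces it by another coefficient from A; no
  exponent changes.\<close>

lemma polys_r: "\<lbrakk>a \<in> A; v \<in> polys A z d\<rbrakk> \<Longrightarrow> v \<otimes> a \<in> polys A z d"
proof (induction d arbitrary: v)
  case (Suc d)
  then obtain w s where *: "w \<in> polys A z d" "s \<in> A" "v = w \<oplus> s \<otimes> z [^] d" by auto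
  obtain a' where a': "a' \<in> A" "z [^] d \<otimes> a = a' \<otimes> z [^] d" using pow_twist Suc.prems(1) by blast
  have "v \<otimes> a = w \<otimes> a \<oplus> s \<otimes> (z [^] d \<otimes> a)"
    using * Suc.prems(1) polys_carr by (simp add: l_distr m_assoc)
  also have "\<dots> = w \<otimes> a \<oplus> (s \<otimes> a') \<otimes> z [^] d"
    using * a' by (simp add: m_assoc)
  finally show ?case using polys_SucI[OF Suc.IH[OF Suc.prems(1) *(1)] base_mult[OF *(2) a'(1)]]
    by simp
qed simp

lemma polys_pow: "v \<in> polys A z d \<Longrightarrow> v \<otimes> z [^] (i::nat) \<in> polys A z (d + i)"
proof (induction d arbitrary: v)
  case 0
  then show ?case using polys_zero by simp
next
  case (Suc d)
  then obtain w s where *: "w \<in> polys A z d" "s \<in> A" "v = w \<oplus> s \<otimes> z [^] d" by auto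
  have "v \<otimes> z [^] i = w \<otimes> z [^] i \<oplus> s \<otimes> z [^] (d + i)"
    using * polys_carr by (simp add: l_distr m_assoc nat_pow_mult)
  then show ?case using polys_SucI[OF Suc.IH[OF *(1)] *(2)] by simp
qed

lemma polys_mult: "\<lbrakk>u \<in> polys A z d; v \<in> polys A z e\<rbrakk> \<Longrightarrow> u \<otimes> v \<in> polys A z (d + e)"
proof (induction e arbitrary: v)
  case 0
  then show ?case using polys_zero polys_carr by simp
next
  case (Suc e)
  then obtain w s where *: "w \<in> polys A z e" "s \<in> A" "v = w \<oplus> s \<otimes> z [^] e" by auto
  have "u \<otimes> v = u \<otimes> w \<oplus> (u \<otimes> s) \<otimes> z [^] e"
    using * Suc.prems(1) polys_carr by (simp add: r_distr m_assoc)
  also have "\<dots> \<in> polys A z (d + Suc e)"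
  proof (rule polys_add)
    show "u \<otimes> w \<in> polys A z (d + Suc e)" "(u \<otimes> s) \<otimes> z [^] e \<in> polys A z (d + Suc e)"
    using Suc.IH[OF Suc.prems(1) *(1)] polys_pow[OF polys_r[OF *(2) Suc.prems(1)], of e]
      polys_mono[of "d + e" "d + Suc e"] by auto
  qed
  finally show ?case .
qed

text \<open>As z^d is homogeneous, the even component of s z^d is \<open>ev s\<close> or
  \<open>od s\<close> times z^d, according to the parity of z^d.\<close>

lemma polys_ev: "v \<in> polys A z d \<Longrightarrow> ev v \<in> polys A z d"
proof (induction d arbitrary: v)
  case (Suc d)
  then obtain w s where *: "w \<in> polys A z d" "s \<in> A" "v = w \<oplus> s \<otimes> z [^] d" by auto
  obtain t where t: "t \<in> A" "ev (s \<otimes> z [^] d) = t \<otimes> z [^] d"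
    using homog_pow[OF z, of d] *(2) ev_mult_even[of s "z [^] d"] ev_mult_odd[of s "z [^] d"]
      subsuper_ring_ev[OF A *(2)] subsuper_ring_od[OF A *(2)] by auto
  have "ev v = ev w \<oplus> t \<otimes> z [^] d" using * t polys_carr by (simp add: ev_add)
  then show ?case using polys_SucI[OF Suc.IH[OF *(1)] t(1)] by simp
qed (simp add: ev_id)

lemma polys_2:
  assumes "u \<in> adj A z" "v \<in> adj A z"
  shows "\<exists>d. u \<in> polys A z d \<and> v \<in> polys A z d"
proof -
  obtain i j where "u \<in> polys A z i" "v \<in> polys A z j" using assms by (auto simp: adj_def)
  then show ?thesis using polys_mono[of i "max i j"] polys_mono[of j "max i j"] by auto
qed

lemma adjI: "v \<in> polys A z d \<Longrightarrow> v \<in> adj A z"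
  by (auto simp: adj_def)

lemma base_subset_adj: "A \<subseteq> adj A z"
  using polys_monom[of _ 0 1] adjI by fastforce

lemma gen_in_adj: "z \<in> adj A z"
  using polys_monom[OF base_one, of 1 2] adjI by fastforce

lemma adj_asub: "additive_subgroup (adj A z) R"
proof (rule additive_subgroup_closedI)
  show "u \<oplus> v \<in> adj A z" if "u \<in> adj A z" "v \<in> adj A z" for u v
    using polys_2[OF that] polys_add adjI by blast
  show "\<ominus> u \<in> adj A z" if "u \<in> adj A z" for u
    using polys_2[OF that that] polys_neg adjI by blast
qed (use adjI[OF polys_zero] polys_carr in \<open>auto simp: adj_def\<close>)

lemma subsuper_ring_adj: "subsuper_ring (adj A z)"
  unfolding subsuper_ring_def
proof (intro conjI ballI adj_asub)
  show "\<one> \<in> adj A z" using base_subset_adj base_one by blast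
  show "u \<otimes> v \<in> adj A z" if "u \<in> adj A z" "v \<in> adj A z" for u v
    using polys_2[OF that] polys_mult adjI by blast
  show "ev u \<in> adj A z" if "u \<in> adj A z" for u
    using polys_2[OF that that] polys_ev adjI by blast
qed

text \<open>All coefficients that can stand at z^d in some expression, with exponents at most d, of
  some element of J. One element may contribute several coefficients, and 0 is allowed.\<close>

definition lead :: "nat \<Rightarrow> 'a set \<Rightarrow> 'a set"
  where "lead d J = {a \<in> A. \<exists>v\<in>polys A z d. v \<oplus> a \<otimes> z [^] d \<in> J}"

lemma leadI: "\<lbrakk>a \<in> A; v \<in> polys A z d; v \<oplus> a \<otimes> z [^] d \<in> J\<rbrakk> \<Longrightarrow> a \<in> lead d J"
  by (auto simp: lead_def)

lemma lead_graded_ideal: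
  assumes J: "graded_ideal (adj A z) J"
  shows "graded_ideal A (lead d J)"
  unfolding graded_ideal_def
proof (intro conjI ballI additive_subgroup_closedI)
  note Ja = graded_ideal_asub[OF J]
  show "lead d J \<subseteq> A" "lead d J \<subseteq> carrier R" by (auto simp: lead_def)
  show "\<zero> \<in> lead d J" using leadI[OF base_zero polys_zero, of d J] asub_zero[OF Ja] by simp
  fix a assume "a \<in> lead d J"
  then obtain v where a: "a \<in> A" "v \<in> polys A z d" "v \<oplus> a \<otimes> z [^] d \<in> J" by (auto simp: lead_def)
  have [simp]: "a \<in> carrier R" "v \<in> carrier R" using a polys_carr by auto
  have "\<ominus> v \<oplus> (\<ominus> a) \<otimes> z [^] d = \<ominus> (v \<oplus> a \<otimes> z [^] d)" by (simp add: l_minus minus_add)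
  then show "\<ominus> a \<in> lead d J"
    using leadI[OF base_neg[OF a(1)] polys_neg[OF a(2)]] asub_neg[OF Ja a(3)] by simp
  show "a \<oplus> b \<in> lead d J" if bl: "b \<in> lead d J" for b
  proof -
    obtain w where b: "b \<in> A" "w \<in> polys A z d" "w \<oplus> b \<otimes> z [^] d \<in> J" using bl by (auto simp: lead_def)
    have [simp]: "b \<in> carrier R" "w \<in> carrier R" using b polys_carr by auto
    have "(v \<oplus> w) \<oplus> (a \<oplus> b) \<otimes> z [^] d = (v \<oplus> a \<otimes> z [^] d) \<oplus> (w \<oplus> b \<otimes> z [^] d)"
      by (simp add: l_distr a_ac)
    then show ?thesis
      using leadI[OF base_add[OF a(1) b(1)] polys_add[OF a(2) b(2)]] asub_add[OF Ja a(3) b(3)] by simp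
  qed
  show "b \<otimes> a \<in> lead d J" if b: "b \<in> A" for b
  proof -
    have [simp]: "b \<in> carrier R" using b by simp
    have "b \<otimes> v \<oplus> (b \<otimes> a) \<otimes> z [^] d = b \<otimes> (v \<oplus> a \<otimes> z [^] d)"
      by (simp add: r_distr m_assoc)
    then show ?thesis
      using leadI[OF base_mult[OF b a(1)] polys_l[OF b a(2)]] graded_ideal_l[OF J, of b] base_subset_adj b a(3) 
      by auto
  qed
  have evv: "ev v \<in> polys A z d" using polys_ev a by blast
  then have odv: "od v \<in> polys A z d" using polys_diff[OF a(2)] by (simp add: od_def)
  \<comment> \<open>If z^d is odd, the projection to be applied to the element of J is
    \<open>od\<close>, not \<open>ev\<close>: its coefficient at z^d is again \<open>ev a\<close>,
    because multiplication by an odd element exchanges the parities.\<close>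
  show "ev a \<in> lead d J"
  proof (cases "z [^] d \<in> even_part R")
    case True
    then have "ev (v \<oplus> a \<otimes> z [^] d) = ev v \<oplus> ev a \<otimes> z [^] d"
      by (simp add: ev_add ev_mult_even)
    then show ?thesis using leadI[OF subsuper_ring_ev[OF A a(1)] evv] graded_ideal_ev[OF J a(3)] by simp
  next
    case False
    then have "z [^] d \<in> odd_part R" using homog_pow[OF z, of d] by blast
    then have "od (v \<oplus> a \<otimes> z [^] d) = od v \<oplus> ev a \<otimes> z [^] d"
      by (simp add: od_add od_mult_odd)
    then show ?thesis using leadI[OF subsuper_ring_ev[OF A a(1)] odv] graded_ideal_od[OF J a(3)] by simp
  qed
qed

text \<open>Multiplication by z on the right raises every exponent by one and keeps the leading
  coefficient; J absorbs it because J is graded.\<close>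

lemma lead_Suc:
  assumes J: "graded_ideal (adj A z) J"
  shows "lead d J \<subseteq> lead (Suc d) J"
proof
  fix a assume "a \<in> lead d J"
  then obtain v where a: "a \<in> A" "v \<in> polys A z d" "v \<oplus> a \<otimes> z [^] d \<in> J" by (auto simp: lead_def)
  have [simp]: "a \<in> carrier R" "v \<in> carrier R" using a polys_carr by auto
  have "v \<otimes> z \<oplus> a \<otimes> z [^] Suc d = (v \<oplus> a \<otimes> z [^] d) \<otimes> z"
    by (simp add: l_distr m_assoc)
  then show "a \<in> lead (Suc d) J"
    using leadI[OF a(1), of "v \<otimes> z" "Suc d"] polys_pow[OF a(2), of 1]
      graded_ideal_r[OF J subsuper_ring_adj gen_in_adj a(3)] by simp
qed

text \<open>From an element of J' subtract an element of J with the same coefficient at the top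
  exponent. The difference lies in J' and has an expression with a smaller bound, so induction on
  the bound applies.\<close>

lemma lead_eq_imp_subset:
  assumes J: "graded_ideal (adj A z) J" "graded_ideal (adj A z) J'" "J \<subseteq> J'"
    and eq: "\<And>d. lead d J' = lead d J"
  shows "J' \<subseteq> J"
proof -
  have "v \<in> J' \<Longrightarrow> v \<in> J" if "v \<in> polys A z d" for v d
    using that
  proof (induction d arbitrary: v)
    case 0
    then show ?case using asub_zero[OF graded_ideal_asub[OF J(1)]] by simp
  next
    case (Suc d)
    then obtain w a where v: "w \<in> polys A z d" "a \<in> A" "v = w \<oplus> a \<otimes> z [^] d" by auto
    have "a \<in> lead d J'"
      by (rule leadI[OF v(2,1)]) (use Suc.prems(1) v(3) in simp)
    then have "a \<in> lead d J" unfolding eq .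
    then obtain u where u: "u \<in> polys A z d" "u \<oplus> a \<otimes> z [^] d \<in> J" by (auto simp: lead_def)
    have c: "w \<in> carrier R" "u \<in> carrier R" "a \<otimes> z [^] d \<in> carrier R" using v u polys_carr by auto
    have *: "w \<ominus> u = v \<ominus> (u \<oplus> a \<otimes> z [^] d)" "v = (w \<ominus> u) \<oplus> (u \<oplus> a \<otimes> z [^] d)"
      unfolding v(3) using c by algebra+
    have "v \<ominus> (u \<oplus> a \<otimes> z [^] d) \<in> J'"
      using asub_diff[OF graded_ideal_asub[OF J(2)]] Suc.prems u(2) J(3) by blast
    then have "w \<ominus> u \<in> J'" unfolding *(1) .
    then have "w \<ominus> u \<in> J" by (rule Suc.IH[OF _ polys_diff[OF v(1) u(1)]])
    then show ?case unfolding *(2) using asub_add[OF graded_ideal_asub[OF J(1)] _ u(2)] by blast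
  qed
  then show ?thesis using graded_ideal_sub[OF J(2)] by (auto simp: adj_def)
qed

text \<open>Hilbert's argument does not need \<open>z\<close> to be even: it is enough that \<open>z\<close> supercommutes with \<open>A\<close>.\<close>

theorem graded_noetherian_adj:
  assumes noeth: "graded_noetherian A"
  shows "graded_noetherian (adj A z)"
  unfolding graded_noetherian_def
proof (intro allI impI, elim conjE)
  fix J :: "nat \<Rightarrow> 'a set"
  assume J: "\<forall>n. graded_ideal (adj A z) (J n)" and mono: "\<forall>n. J n \<subseteq> J (Suc n)"
  \<comment> \<open>The ideals of leading coefficients increase both in the exponent and along the
    given chain. One threshold valid for all exponents is needed in order to compare the members of
    the chain themselves.\<close>
  have "\<exists>N. \<forall>n\<ge>N. \<forall>d. lead d (J n) = lead d (J N)"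
  proof (rule double_chain_stabilizes[where Q = "graded_ideal A"])
    show "lead d (J n) \<subseteq> lead (Suc d) (J n)" for d n using lead_Suc J by blast
    show "lead d (J n) \<subseteq> lead d (J (Suc n))" for d n using mono by (auto simp: lead_def)
    show "graded_ideal A (lead d (J n))" for d n using lead_graded_ideal J by blast
  qed (use noeth in \<open>auto simp: graded_noetherian_def\<close>)
  then obtain N where N: "\<And>n d. n \<ge> N \<Longrightarrow> lead d (J n) = lead d (J N)" by blast
  have "J n = J N" if n: "n \<ge> N" for n
  proof -
    have sub: "J N \<subseteq> J n" by (rule lift_Suc_mono_le[of J, OF mono[rule_format] n])
    show ?thesis
      by (rule equalityI[OF lead_eq_imp_subset[OF J[rule_format] J[rule_format] sub N[OF n]] sub])
  qed
  then show "\<exists>N. \<forall>n\<ge>N. J n = J N" by blast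
qed

end

end


section \<open>Adjoining a homogeneous element: the Krull dimension\<close>

context super_ring
begin

text \<open>Primes of a subring C of the even part, which is commutative, so that left
  multiplication and products of elements suffice. Having C as a parameter makes contraction to a
  smaller subring a mere intersection.\<close>

definition prime_in :: "'a set \<Rightarrow> 'a set \<Rightarrow> bool"
  where "prime_in C P \<longleftrightarrow> additive_subgroup P R \<and> P \<subseteq> C \<and> (\<forall>a\<in>C. \<forall>x\<in>P. a \<otimes> x \<in> P) \<and> \<one> \<notin> P
    \<and> (\<forall>a\<in>C. \<forall>b\<in>C. a \<otimes> b \<in> P \<longrightarrow> a \<in> P \<or> b \<in> P)"

text \<open>A bound instead of a value: only finiteness has to be tracked, and a ring without primes
  satisfies it for every d.\<close>

definition dim_le :: "'a set \<Rightarrow> nat \<Rightarrow> bool"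
  where "dim_le C d \<longleftrightarrow> (\<forall>n P. (\<forall>i\<le>n. prime_in C (P i)) \<and> (\<forall>i<n. P i \<subset> P (Suc i)) \<longrightarrow> n \<le> d)"

lemma dim_leI:
  assumes "\<And>n P. \<lbrakk>\<And>i. i \<le> n \<Longrightarrow> prime_in C (P i); \<And>i. i < n \<Longrightarrow> P i \<subset> P (Suc i)\<rbrakk> \<Longrightarrow> n \<le> d"
  shows "dim_le C d"
  using assms unfolding dim_le_def by blast

lemma dim_leD:
  assumes "dim_le C d" "\<And>i. i \<le> n \<Longrightarrow> prime_in C (P i)" "\<And>i. i < n \<Longrightarrow> P i \<subset> P (Suc i)"
  shows "n \<le> d"
  using assms unfolding dim_le_def by blast

lemma
  assumes "prime_in C P"
  shows prime_in_asub: "additive_subgroup P R"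
    and prime_in_sub: "P \<subseteq> C"
    and prime_in_l: "\<lbrakk>a \<in> C; x \<in> P\<rbrakk> \<Longrightarrow> a \<otimes> x \<in> P"
    and prime_in_one: "\<one> \<notin> P"
    and prime_in_prime: "\<lbrakk>a \<in> C; b \<in> C; a \<otimes> b \<in> P\<rbrakk> \<Longrightarrow> a \<in> P \<or> b \<in> P"
  using assms unfolding prime_in_def by blast+

lemma subsuper_ring_pow: "\<lbrakk>subsuper_ring A; a \<in> A\<rbrakk> \<Longrightarrow> a [^] (n::nat) \<in> A"
  by (induction n) (auto simp: subsuper_ring_def)

lemma prime_in_pow:
  assumes "prime_in C P" "subsuper_ring C" "c \<in> C" "c \<notin> P"
  shows "c [^] (n::nat) \<notin> P"
proof (induction n)
  case 0
  then show ?case using prime_in_one[OF assms(1)] by simp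
next
  case (Suc n)
  then show ?case using prime_in_prime[OF assms(1) subsuper_ring_pow[OF assms(2,3), of n] assms(3)] assms(4) by auto
qed

lemma asub_inter: "\<lbrakk>additive_subgroup X R; additive_subgroup Y R\<rbrakk> \<Longrightarrow> additive_subgroup (X \<inter> Y) R"
  by (auto simp: additive_subgroup_alt[OF ring_axioms])

lemma prime_in_contract:
  assumes P: "prime_in D P" and C: "subsuper_ring C" "C \<subseteq> D"
  shows "prime_in C (P \<inter> C)"
proof -
  have "additive_subgroup (P \<inter> C) R"
    using asub_inter prime_in_asub[OF P] subsuper_ring_asub[OF C(1)] by blast
  moreover have "a \<otimes> x \<in> P \<inter> C" if "a \<in> C" "x \<in> P \<inter> C" for a x
    using prime_in_l[OF P, of a x] subsuper_ring_mult[OF C(1), of a x] C(2) that by blast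
  moreover have "a \<in> P \<inter> C \<or> b \<in> P \<inter> C" if "a \<in> C" "b \<in> C" "a \<otimes> b \<in> P \<inter> C" for a b
    using prime_in_prime[OF P, of a b] C(2) that by blast
  ultimately show ?thesis unfolding prime_in_def
    using prime_in_one[OF P] by simp
qed

lemma subsuper_ring_even: "subsuper_ring A \<Longrightarrow> subsuper_ring (A \<inter> even_part R)"
  unfolding subsuper_ring_def using even_asub asub_inter even_even by (auto simp: ev_id)

text \<open>An element t with t t = 0 lies in every prime of D. Hence whether x = c + t belongs to a
  prime depends on c alone, primes of D are determined by their contractions to C, and strict
  inclusions survive contraction.\<close>

lemma dim_le_nilpotent:
  assumes C: "subsuper_ring C" "C \<subseteq> D" and D: "D \<subseteq> carrier R"
    and nil: "\<And>x. x \<in> D \<Longrightarrow> \<exists>c\<in>C. \<exists>t\<in>D. x = c \<oplus> t \<and> t \<otimes> t = \<zero>"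
    and dim: "dim_le C d"
  shows "dim_le D d"
proof (rule dim_leI)
  fix n P assume P: "\<And>i. i \<le> n \<Longrightarrow> prime_in D (P i)" and chain: "\<And>i. i < n \<Longrightarrow> P i \<subset> P (Suc i)"
  show "n \<le> d"
  proof (rule dim_leD[OF dim, of n "\<lambda>i. P i \<inter> C"])
    show "prime_in C (P i \<inter> C)" if "i \<le> n" for i
      using prime_in_contract[OF P[OF that] C] .
    show "P i \<inter> C \<subset> P (Suc i) \<inter> C" if i: "i < n" for i
    proof -
      have p: "prime_in D (P i)" "prime_in D (P (Suc i))" using P i by auto
      obtain x where x: "x \<in> P (Suc i)" "x \<notin> P i" using chain[OF i] by blast
      then obtain c t where ct: "c \<in> C" "t \<in> D" "x = c \<oplus> t" "t \<otimes> t = \<zero>"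
        using nil prime_in_sub[OF p(2)] by blast
      have t: "t \<in> P i" "t \<in> P (Suc i)"
        using prime_in_prime[OF p(1) ct(2,2)] prime_in_prime[OF p(2) ct(2,2)] ct(4)
          asub_zero[OF prime_in_asub] p by auto
      have "c \<in> P (Suc i)" using asub_cancel[OF prime_in_asub[OF p(2)] _ t(2), of c] ct x(1) C D by auto
      moreover have "c \<notin> P i" using asub_add[OF prime_in_asub[OF p(1)] _ t(1), of c] ct(3) x(2) by auto
      ultimately show ?thesis using chain[OF i] ct(1) by blast
    qed
  qed
qed

section \<open>Adjoining an even element: primes with a common contraction\<close>

context
  fixes C z
  assumes C: "subsuper_ring C" and Ce: "C \<subseteq> even_part R" and ze: "z \<in> even_part R"
begin

lemma gen_homogeneous: "z \<in> even_part R \<union> odd_part R"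
  using ze by blast

lemmas coeff_carr = base_carr[OF C gen_homogeneous] and poly_carr = polys_carr[OF C gen_homogeneous]

lemma polys_even: "v \<in> polys C z d \<Longrightarrow> v \<in> even_part R"
proof (induction d arbitrary: v)
  case (Suc d)
  then show ?case using even_even[of _ "z [^] d"] even_pow[OF ze] Ce asub_add[OF even_asub] by auto
qed simp

text \<open>Long division by g = w + c z^e. The leading coefficient c need not be invertible, so
  each step multiplies the dividend by c once more, and c^N collects these factors. All bounds
  concern chosen expressions; q and r are not unique.\<close>

lemma pseudo_division:
  assumes c: "c \<in> C" and w: "w \<in> polys C z e" and h: "h \<in> polys C z k"
  shows "\<exists>(N::nat) q r. q \<in> polys C z (k - e) \<and> r \<in> polys C z e
    \<and> c [^] N \<otimes> h = q \<otimes> (w \<oplus> c \<otimes> z [^] e) \<oplus> r"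
  using h
proof (induction k arbitrary: h)
  case 0
  show ?case
    by (rule exI[of _ 0], rule exI[of _ \<zero>], rule exI[of _ \<zero>])
      (use 0 w c polys_zero[OF C gen_homogeneous] poly_carr coeff_carr ze in auto)
next
  case (Suc k)
  have [simp]: "c \<in> carrier R" "w \<in> carrier R" "z \<in> carrier R" "h \<in> carrier R"
    using c w coeff_carr poly_carr ze Suc.prems by auto
  show ?case
  proof (cases "Suc k \<le> e")
    \<comment> \<open>The exponents of h are already below e, so h is its own remainder; the
      truncated difference makes the bound for the quotient 0.\<close>
    case True
    then show ?thesis
      by (intro exI[of _ 0] exI[of _ \<zero>] exI[of _ h])
        (use Suc.prems polys_zero[OF C gen_homogeneous] polys_mono[OF C gen_homogeneous True] in auto)
  next
    case False
    then have k: "e \<le> k" by simp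
    obtain v b where h: "v \<in> polys C z k" "b \<in> C" "h = v \<oplus> b \<otimes> z [^] k" using Suc.prems by auto
    have [simp]: "v \<in> carrier R" "b \<in> carrier R" using h coeff_carr poly_carr by auto
    define m where "m = b \<otimes> z [^] (k - e)"
    define g where "g = w \<oplus> c \<otimes> z [^] e"
    \<comment> \<open>This is c h - m g after the terms with z^k have cancelled: m is chosen so that
      m c z^e = c b z^k.\<close>
    define h' where "h' = c \<otimes> v \<ominus> m \<otimes> w"
    have [simp]: "m \<in> carrier R" "g \<in> carrier R" "h' \<in> carrier R" by (simp_all add: m_def g_def h'_def)
    have m: "m \<in> polys C z (Suc (k - e))" using polys_monom[OF C gen_homogeneous h(2), of "k - e" "Suc (k - e)"]
      by (simp add: m_def)
    have "z [^] (k - e) \<otimes> w = w \<otimes> z [^] (k - e)"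
      using even_commute[of "z [^] (k - e)" w] even_pow[OF ze] polys_even[OF w] by simp
    then have "m \<otimes> w = b \<otimes> (w \<otimes> z [^] (k - e))" by (simp add: m_def m_assoc)
    moreover have "w \<otimes> z [^] (k - e) \<in> polys C z k"
      using polys_pow[OF C gen_homogeneous w, of "k - e"] k by simp
    ultimately have "h' \<in> polys C z k"
      unfolding h'_def using polys_diff[OF C gen_homogeneous polys_l[OF C gen_homogeneous c h(1)]] polys_l[OF C gen_homogeneous h(2)] by simp
    from Suc.IH[OF this] obtain N q r where
      IH: "q \<in> polys C z (k - e)" "r \<in> polys C z e" "c [^] (N::nat) \<otimes> h' = q \<otimes> g \<oplus> r"
      unfolding g_def by blast
    have [simp]: "q \<in> carrier R" "r \<in> carrier R" using IH poly_carr by auto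
    have "m \<otimes> c = c \<otimes> m"
      using even_commute[of c m] c Ce polys_even[OF m] by auto
    then have "m \<otimes> (c \<otimes> z [^] e) = c \<otimes> (m \<otimes> z [^] e)"
      by (simp add: m_assoc[symmetric])
    also have "\<dots> = c \<otimes> (b \<otimes> z [^] k)"
      using k by (simp add: m_def m_assoc nat_pow_mult)
    finally have "m \<otimes> g = m \<otimes> w \<oplus> c \<otimes> (b \<otimes> z [^] k)"
      by (simp add: g_def r_distr)
    then have ch: "c \<otimes> h = h' \<oplus> m \<otimes> g"
    proof -
      have cc: "c \<otimes> v \<in> carrier R" "m \<otimes> w \<in> carrier R" "c \<otimes> (b \<otimes> z [^] k) \<in> carrier R" by simp_all
      have "(c \<otimes> v \<ominus> m \<otimes> w) \<oplus> (m \<otimes> w \<oplus> c \<otimes> (b \<otimes> z [^] k)) = c \<otimes> v \<oplus> c \<otimes> (b \<otimes> z [^] k)"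
        using cc by algebra
      then show ?thesis unfolding h'_def \<open>m \<otimes> g = _\<close> h(3) by (simp add: r_distr)
    qed
    have "c [^] Suc N \<otimes> h = c [^] N \<otimes> (c \<otimes> h)" by (simp add: m_assoc)
    also have "\<dots> = (q \<otimes> g \<oplus> r) \<oplus> (c [^] N \<otimes> m) \<otimes> g"
      unfolding ch by (simp add: r_distr m_assoc IH(3))
    also have "\<dots> = (q \<oplus> c [^] N \<otimes> m) \<otimes> g \<oplus> r"
      by (simp add: l_distr a_ac)
    finally have "c [^] Suc N \<otimes> h = (q \<oplus> c [^] N \<otimes> m) \<otimes> g \<oplus> r" .
    moreover have "q \<oplus> c [^] N \<otimes> m \<in> polys C z (Suc k - e)"
    proof -
      have "q \<in> polys C z (Suc (k - e))"
        using polys_mono[OF C gen_homogeneous, of "k - e" "Suc (k - e)"] IH(1) by (meson le_SucI order_refl subsetD)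
      then show ?thesis unfolding Suc_diff_le[OF k]
        using polys_l[OF C gen_homogeneous subsuper_ring_pow[OF C c] m, of N] by (rule polys_add[OF C gen_homogeneous])
    qed
    ultimately show ?thesis using IH(2) unfolding g_def by blast
  qed
qed

text \<open>A generator adjoins at most one dimension to each fibre: \<open>C \<inter> P2 \<subseteq> P0\<close> says that the three
  primes have the same contraction.\<close>

lemma no_three_primes:
  assumes P: "prime_in (adj C z) P0" "prime_in (adj C z) P1" "prime_in (adj C z) P2"
    and sub: "P0 \<subset> P1" "P1 \<subset> P2" and same: "P2 \<inter> C \<subseteq> P0"
  shows False
proof -
  have D: "subsuper_ring (adj C z)" and CD: "C \<subseteq> adj C z" and zD: "z \<in> adj C z"
    using subsuper_ring_adj[OF C gen_homogeneous] base_subset_adj[OF C gen_homogeneous] gen_in_adj[OF C gen_homogeneous] .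
  have pD: "v \<in> adj C z" if "v \<in> polys C z k" for v k using that adjI[OF C gen_homogeneous] by blast
  have De: "x \<in> even_part R" if "x \<in> adj C z" for x
    using that polys_even by (auto simp: adj_def)
  have [simp]: "x \<in> carrier R" if "x \<in> adj C z" for x using De that by simp
  \<comment> \<open>The exponents at which P2 has an element whose leading coefficient is nonzero
    modulo the common contraction. The least one, e, yields g, the analogue of a generator of the
    image of P2 over the field of fractions.\<close>
  define S where "S = {j. \<exists>a\<in>C - P2. \<exists>w\<in>polys C z j. w \<oplus> a \<otimes> z [^] j \<in> P2}"
  \<comment> \<open>Below all exponents of \<open>S\<close> the top coefficient lies in P2 and C,
    hence in P0; removing that term leaves an element of P2 with a smaller bound.\<close>
  have low: "h \<in> P0" if "h \<in> polys C z k" "h \<in> P2" "\<And>j. j < k \<Longrightarrow> j \<notin> S" for h k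
    using that
  proof (induction k arbitrary: h)
    case 0
    then show ?case using asub_zero prime_in_asub[OF P(1)] by simp
  next
    case (Suc k)
    then obtain v a where h: "v \<in> polys C z k" "a \<in> C" "h = v \<oplus> a \<otimes> z [^] k" by auto
    then have "a \<in> P2" using Suc.prems(2) Suc.prems(3)[of k] by (auto simp: S_def)
    then have "a \<in> P0" using h same by blast
    then have "z [^] k \<otimes> a \<in> P0" using prime_in_l[OF P(1) subsuper_ring_pow[OF D zD]] by blast
    then have *: "a \<otimes> z [^] k \<in> P0" using even_commute[of a "z [^] k"] h(2) Ce even_pow[OF ze] by auto
    have "v \<in> P2"
      using asub_cancel[OF prime_in_asub[OF P(3)] poly_carr[OF h(1)], of "a \<otimes> z [^] k"] * sub Suc.prems(2) h(3)
      by auto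
    then have "v \<in> P0" using Suc.IH[of v] h(1) Suc.prems(3) by simp
    then show ?case unfolding h(3) using * asub_add[OF prime_in_asub[OF P(1)]] by blast
  qed
  have "S \<noteq> {}"
  proof
    assume S: "S = {}"
    have "P2 \<subseteq> P0"
    proof
      fix h assume h: "h \<in> P2"
      then obtain k where "h \<in> polys C z k" using prime_in_sub[OF P(3)] by (auto simp: adj_def)
      then show "h \<in> P0" using low[of h k] h S by blast
    qed
    then show False using sub by blast
  qed
  then obtain e where e: "e \<in> S" "\<And>j. j < e \<Longrightarrow> j \<notin> S"
    using exists_least_iff[of "\<lambda>j. j \<in> S"] by blast
  then obtain c w where c: "c \<in> C" "c \<notin> P2" and w: "w \<in> polys C z e" and gP: "w \<oplus> c \<otimes> z [^] e \<in> P2"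
    by (auto simp: S_def)
  define g where "g = w \<oplus> c \<otimes> z [^] e"
  have g: "g \<in> P2" "g \<in> adj C z" using gP prime_in_sub[OF P(3)] by (auto simp: g_def)
  \<comment> \<open>This makes the bound k - e of a quotient strictly smaller than k, on which the
    induction for P1 below relies.\<close>
  have "e \<noteq> 0"
  proof
    assume "e = 0"
    then have "g = c" using w coeff_carr[OF c(1)] by (simp add: g_def)
    then show False using g c by blast
  qed
  \<comment> \<open>The remainder of an element of P2 is in P2 with exponents below e, and by
    minimality of e it falls into P0. Up to powers of c and modulo P0, every element of P2 is a
    multiple of g.\<close>
  have red: "\<exists>(N::nat) q r. q \<in> polys C z (k - e) \<and> r \<in> P0 \<and> c [^] N \<otimes> h = q \<otimes> g \<oplus> r"
    if h: "h \<in> polys C z k" "h \<in> P2" for h k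
  proof -
    obtain N q r where *: "q \<in> polys C z (k - e)" "r \<in> polys C z e" "c [^] (N::nat) \<otimes> h = q \<otimes> g \<oplus> r"
      using pseudo_division[OF c(1) w h(1)] unfolding g_def by blast
    have "c [^] N \<otimes> h \<in> P2" "q \<otimes> g \<in> P2"
      using prime_in_l[OF P(3)] h(2) g(1) pD *(1) subsuper_ring_pow[OF C c(1)] CD by blast+
    then have "r \<in> P2"
      using asub_cancel[OF prime_in_asub[OF P(3)], of r "q \<otimes> g"] *(3) poly_carr[OF *(2)]
        g(2) pD[OF *(1)] by (simp add: a_comm)
    then have "r \<in> P0" using low[OF *(2)] e by blast
    then show ?thesis using * by blast
  qed
  \<comment> \<open>Powers of c can be cancelled in any prime below P2, because c is not in
    P2.\<close>
  have cancel: "h \<in> P" if "prime_in (adj C z) P" "P \<subseteq> P2" "c [^] (N::nat) \<otimes> h \<in> P" "h \<in> adj C z" for P h N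
    using prime_in_prime[OF that(1) _ that(4,3)] prime_in_pow[OF that(1) D, of c N] c CD that(2)
      subsuper_ring_pow[OF D] by blast
  have "g \<in> P1"
  proof (rule ccontr)
    assume gn: "g \<notin> P1"
    \<comment> \<open>If g is not in P1, primality pushes the quotient q of f into P1. The bound of
      q is smaller, so q is in P0 by induction, and then so is f.\<close>
    have "f \<in> polys C z k \<Longrightarrow> f \<in> P1 \<Longrightarrow> f \<in> P0" for f k
    proof (induction k arbitrary: f rule: less_induct)
      case (less k)
      show ?case
      proof (cases "k = 0")
        case True
        then show ?thesis using less.prems asub_zero[OF prime_in_asub[OF P(1)]] by simp
      next
        case False
        obtain N q r where *: "q \<in> polys C z (k - e)" "r \<in> P0" "c [^] (N::nat) \<otimes> f = q \<otimes> g \<oplus> r"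
          using red[OF less.prems(1)] less.prems(2) sub by blast
        have fP: "c [^] N \<otimes> f \<in> P1"
          using prime_in_l[OF P(2)] less.prems(2) subsuper_ring_pow[OF C c(1)] CD by blast
        have "q \<otimes> g \<in> P1"
          by (rule asub_cancel[OF prime_in_asub[OF P(2)], of _ r])
            (use fP *(2,3) sub g(2) pD[OF *(1)] in auto)
        then have "q \<in> P1" using prime_in_prime[OF P(2) pD[OF *(1)] g(2)] gn by blast
        then have "q \<in> P0" using less.IH[OF _ *(1)] False \<open>e \<noteq> 0\<close> by simp
        then have "g \<otimes> q \<in> P0" using prime_in_l[OF P(1) g(2)] by blast
        then have "q \<otimes> g \<in> P0" using even_commute[of q g] De[OF g(2)] De[OF pD[OF *(1)]] by simp
        then have "c [^] N \<otimes> f \<in> P0" unfolding *(3) using asub_add[OF prime_in_asub[OF P(1)]] *(2) by blast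
        then show ?thesis using cancel[OF P(1)] sub pD[OF less.prems(1)] by blast
      qed
    qed
    then have "P1 \<subseteq> P0" using prime_in_sub[OF P(2)] by (auto simp: adj_def)
    then show False using sub by blast
  qed
  \<comment> \<open>With g in P1, the reduction by g puts c^N h into P1 for every h of P2.\<close>
  have "P2 \<subseteq> P1"
  proof
    fix h assume h: "h \<in> P2"
    then obtain k where k: "h \<in> polys C z k" using prime_in_sub[OF P(3)] by (auto simp: adj_def)
    obtain N q r where *: "q \<in> polys C z (k - e)" "r \<in> P0" "c [^] (N::nat) \<otimes> h = q \<otimes> g \<oplus> r"
      using red[OF k h] by blast
    have "c [^] N \<otimes> h \<in> P1" unfolding *(3)
      using prime_in_l[OF P(2) pD[OF *(1)] \<open>g \<in> P1\<close>] *(2) sub asub_add[OF prime_in_asub[OF P(2)]] by blast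
    then show "h \<in> P1" using cancel[OF P(2)] sub pD[OF k] by blast
  qed
  then show False using sub by blast
qed

text \<open>The primes of even index have strictly increasing contractions, so a chain of length n
  gives one of length \<open>n div 2\<close> in C. From \<open>n div 2\<close> \<le> d follows n
  \<le> 2d + 1, the 1 accounting for odd n.\<close>

lemma dim_le_adj:
  assumes dim: "dim_le C d"
  shows "dim_le (adj C z) (2 * d + 1)"
proof (rule dim_leI)
  fix n P assume P: "\<And>i. i \<le> n \<Longrightarrow> prime_in (adj C z) (P i)" and chain: "\<And>i. i < n \<Longrightarrow> P i \<subset> P (Suc i)"
  have "n div 2 \<le> d"
  proof (rule dim_leD[OF dim, of _ "\<lambda>i. P (2 * i) \<inter> C"])
    show "prime_in C (P (2 * i) \<inter> C)" if "i \<le> n div 2" for i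
      using prime_in_contract[OF P C base_subset_adj[OF C gen_homogeneous]] that by simp
    show "P (2 * i) \<inter> C \<subset> P (2 * Suc i) \<inter> C" if i: "i < n div 2" for i
    proof -
      have *: "P (2 * i) \<subset> P (Suc (2 * i))" "P (Suc (2 * i)) \<subset> P (Suc (Suc (2 * i)))"
        using chain i by auto
      moreover have "2 * i \<le> n" "Suc (2 * i) \<le> n" "Suc (Suc (2 * i)) \<le> n" using i by auto
      ultimately have "\<not> P (Suc (Suc (2 * i))) \<inter> C \<subseteq> P (2 * i)"
        using no_three_primes[OF P P P *] by blast
      then show ?thesis using * by auto
    qed
  qed
  then show "n \<le> 2 * d + 1" by simp
qed

end

definition noeth_findim :: "'a set \<Rightarrow> bool"
  where "noeth_findim A \<longleftrightarrow> subsuper_ring A \<and> graded_noetherian A \<and> (\<exists>d. dim_le (A \<inter> even_part R) d)"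

text \<open>For even z the projection \<open>ev\<close> acts on the coefficients, so an even element
  has an expression with even coefficients. This reduces the dimension to the commutative
  case.\<close>

lemma even_adj:
  assumes A: "subsuper_ring A" and z: "z \<in> even_part R"
  shows "adj A z \<inter> even_part R = adj (A \<inter> even_part R) z"
proof
  have z': "z \<in> even_part R \<union> odd_part R" using z by blast
  note A' = subsuper_ring_even[OF A]
  have "ev v \<in> polys (A \<inter> even_part R) z d" if "v \<in> polys A z d" for v d
    using that
  proof (induction d arbitrary: v)
    case 0
    then show ?case by (simp add: ev_id)
  next
    case (Suc d)
    then obtain w s where *: "w \<in> polys A z d" "s \<in> A" "v = w \<oplus> s \<otimes> z [^] d" by auto
    have "s \<in> carrier R" "w \<in> carrier R" using * polys_carr[OF A z'] base_carr[OF A z'] by auto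
    then have "ev v = ev w \<oplus> ev s \<otimes> z [^] d" "ev s \<in> A \<inter> even_part R"
      using * z subsuper_ring_ev[OF A] by (simp_all add: ev_add ev_mult_even even_pow)
    then show ?case using polys_SucI[OF A' z' Suc.IH[OF *(1)]] by simp
  qed
  then show "adj A z \<inter> even_part R \<subseteq> adj (A \<inter> even_part R) z"
    unfolding adj_def by (auto simp: ev_id) (metis ev_id)
  have "polys (A \<inter> even_part R) z d \<subseteq> polys A z d" for d by (induction d) auto
  then have "adj (A \<inter> even_part R) z \<subseteq> adj A z" by (auto simp: adj_def)
  then show "adj (A \<inter> even_part R) z \<subseteq> adj A z \<inter> even_part R"
    using polys_even[OF A' _ z] by (auto simp: adj_def)
qed

text \<open>All powers from z^2 on vanish, so only the exponents 0 and 1 contribute.\<close>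

lemma adj_odd_form:
  assumes A: "subsuper_ring A" and z: "z \<in> odd_part R" and v: "v \<in> polys A z d"
  shows "\<exists>a\<in>A. \<exists>b\<in>A. v = a \<oplus> b \<otimes> z"
  using v
proof (induction d arbitrary: v)
  case 0
  then show ?case using asub_zero[OF subsuper_ring_asub[OF A]] z by (intro bexI[of _ \<zero>]) auto
next
  case (Suc d)
  have z': "z \<in> even_part R \<union> odd_part R" using z by blast
  have [simp]: "x \<in> carrier R" if "x \<in> A" for x using that base_carr[OF A z'] by blast
  note add = asub_add[OF subsuper_ring_asub[OF A]]
  obtain w s where *: "w \<in> polys A z d" "s \<in> A" "v = w \<oplus> s \<otimes> z [^] d" using Suc.prems by auto
  obtain a b where ab: "a \<in> A" "b \<in> A" "w = a \<oplus> b \<otimes> z" using Suc.IH[OF *(1)] by blast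
  consider "d = 0" | "d = 1" | m where "d = Suc (Suc m)" by (metis One_nat_def not0_implies_Suc)
  then show ?case
  proof cases
    case 1
    then have "v = s \<oplus> \<zero> \<otimes> z" using * z by simp
    then show ?thesis using asub_zero[OF subsuper_ring_asub[OF A]] * by blast
  next
    case 2
    then have "v = a \<oplus> (b \<oplus> s) \<otimes> z" using ab * z by (simp add: a_ac l_distr)
    then show ?thesis using add ab * by blast
  next
    case 3
    then have "z [^] d = z [^] m \<otimes> (z \<otimes> z)" using z by (simp add: m_assoc)
    then have "z [^] d = \<zero>" using odd_square[OF z] z by simp
    then have "v = a \<oplus> b \<otimes> z" using ab * z by simp
    then show ?thesis using ab by blast
  qed
qed

lemma noeth_findim_adj:
  assumes A: "noeth_findim A" and z: "z \<in> even_part R \<union> odd_part R"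
  shows "noeth_findim (adj A z)"
proof -
  obtain d where As: "subsuper_ring A" and An: "graded_noetherian A" and d: "dim_le (A \<inter> even_part R) d"
    using A by (auto simp: noeth_findim_def)
  have "\<exists>d. dim_le (adj A z \<inter> even_part R) d"
  proof (cases "z \<in> even_part R")
    case True
    then show ?thesis
      using dim_le_adj[OF subsuper_ring_even[OF As] _ True d] even_adj[OF As True] by auto
  next
    case False
    then have zo: "z \<in> odd_part R" using z by blast
    have "dim_le (adj A z \<inter> even_part R) d"
    proof (rule dim_le_nilpotent[OF subsuper_ring_even[OF As] _ _ _ d])
      show "A \<inter> even_part R \<subseteq> adj A z \<inter> even_part R" using base_subset_adj[OF As z] by blast
      show "adj A z \<inter> even_part R \<subseteq> carrier R" by auto
      fix x assume x: "x \<in> adj A z \<inter> even_part R"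
      then obtain a b where ab: "a \<in> A" "b \<in> A" "x = a \<oplus> b \<otimes> z"
        using adj_odd_form[OF As zo, of x] unfolding adj_def by blast
      have [simp]: "a \<in> carrier R" "b \<in> carrier R" "z \<in> carrier R" using ab base_carr[OF As z] z by auto
      \<comment> \<open>Apply \<open>ev\<close> to the even element x = a + b z; multiplication by
        the odd z makes \<open>od b\<close> the relevant component of b. The second summand squares
        to 0, since reordering its factors produces \<open>od b \<otimes> od b\<close>.\<close>
      have e: "x = ev a \<oplus> od b \<otimes> z"
        using ab x zo ev_id[of x] by (simp add: ev_add ev_mult_odd)
      have "z \<otimes> od b = \<ominus> (od b \<otimes> z)" using odd_anticommute[OF zo, of "od b"] by simp
      then have "(od b \<otimes> z) \<otimes> (od b \<otimes> z) = od b \<otimes> (\<ominus> (od b \<otimes> z)) \<otimes> z"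
        by (metis \<open>b \<in> carrier R\<close> \<open>z \<in> carrier R\<close> m_assoc m_closed od_odd odd_carr)
      also have "\<dots> = \<ominus> ((od b \<otimes> od b) \<otimes> z \<otimes> z)"
        by (simp add: r_minus l_minus m_assoc)
      finally have nil: "(od b \<otimes> z) \<otimes> (od b \<otimes> z) = \<zero>" using odd_square[of "od b"] by simp
      have "od b \<otimes> z \<in> adj A z"
        using subsuper_ring_mult[OF subsuper_ring_adj[OF As z]] base_subset_adj[OF As z] gen_in_adj[OF As z]
          subsuper_ring_od[OF As ab(2)] by blast
      then show "\<exists>c\<in>A \<inter> even_part R. \<exists>t\<in>adj A z \<inter> even_part R. x = c \<oplus> t \<and> t \<otimes> t = \<zero>"
        using e nil subsuper_ring_ev[OF As ab(1)] odd_odd[of "od b" z] zo by auto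
    qed
    then show ?thesis by blast
  qed
  then show ?thesis using graded_noetherian_adj[OF As z An] subsuper_ring_adj[OF As z] by (simp add: noeth_findim_def)
qed

lemma noeth_findim_adjoin_finite:
  assumes "finite Z" "Z \<subseteq> even_part R \<union> odd_part R" "noeth_findim A"
  shows "\<exists>B. noeth_findim B \<and> A \<subseteq> B \<and> Z \<subseteq> B"
  using assms
proof (induction Z rule: finite_induct)
  case (insert z Z)
  then obtain B where B: "noeth_findim B" "A \<subseteq> B" "Z \<subseteq> B" by blast
  have z: "z \<in> even_part R \<union> odd_part R" using insert by blast
  have "subsuper_ring B" using B by (simp add: noeth_findim_def)
  then show ?case using noeth_findim_adj[OF B(1) z] base_subset_adj[of B z] gen_in_adj[of B z] z B by blast
qed auto

section \<open>The even part as a commutative ring\<close>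

lemma even_cring: "cring (even_subring R)"
proof (rule cringI)
  show "abelian_group (even_subring R)"
  proof (rule abelian_groupI)
    fix x assume "x \<in> carrier (even_subring R)"
    then have "\<ominus> x \<in> even_part R" "\<ominus> x \<oplus> x = \<zero>"
      using asub_neg[OF even_asub] by (simp_all add: even_subring_def l_neg)
    then show "\<exists>y\<in>carrier (even_subring R). y \<oplus>\<^bsub>even_subring R\<^esub> x = \<zero>\<^bsub>even_subring R\<^esub>"
      by (auto simp: even_subring_def)
  qed (use asub_add[OF even_asub] in \<open>auto simp: even_subring_def a_ac\<close>)
  show "comm_monoid (even_subring R)"
  proof (rule comm_monoidI)
    show "x \<otimes>\<^bsub>even_subring R\<^esub> y = y \<otimes>\<^bsub>even_subring R\<^esub> x"
      if "x \<in> carrier (even_subring R)" "y \<in> carrier (even_subring R)" for x y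
      using that even_commute[of x y] by (simp add: even_subring_def)
  qed (auto simp: even_subring_def m_assoc even_even)
qed (auto simp: even_subring_def l_distr)

lemma primeideal_iff: "primeideal P (even_subring R) \<longleftrightarrow> prime_in (even_part R) P"
proof -
  interpret Ev: cring "even_subring R" by (rule even_cring)
  have [simp]: "carrier (even_subring R) = even_part R" "mult (even_subring R) = mult R"
    "add (even_subring R) = add R" "one (even_subring R) = \<one>" "zero (even_subring R) = \<zero>"
    by (simp_all add: even_subring_def)
  have inv: "\<ominus>\<^bsub>even_subring R\<^esub> x = \<ominus> x" if "x \<in> even_part R" for x
    using that asub_neg[OF even_asub that] by (intro Ev.minus_equality) (auto simp: l_neg)
  have sub: "additive_subgroup P (even_subring R) \<longleftrightarrow> additive_subgroup P R \<and> P \<subseteq> even_part R"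
    unfolding additive_subgroup_alt[OF ring_axioms] additive_subgroup_alt[OF Ev.ring_axioms]
    using inv even_carr by (auto simp: subset_iff)
  show ?thesis
  proof
    assume "primeideal P (even_subring R)"
    then interpret P: primeideal P "even_subring R" .
    have "\<one> \<notin> P"
    proof
      assume "\<one> \<in> P"
      then show False using P.I_notcarr P.one_imp_carrier by simp
    qed
    then show "prime_in (even_part R) P" unfolding prime_in_def
      using sub P.additive_subgroup_axioms P.I_l_closed P.I_prime by auto
  next
    assume P: "prime_in (even_part R) P"
    have "ideal P (even_subring R)"
    proof (rule idealI[OF Ev.ring_axioms])
      show "subgroup P (add_monoid (even_subring R))"
        using sub P by (simp add: prime_in_def additive_subgroup_def)
      show "x \<otimes>\<^bsub>even_subring R\<^esub> a \<in> P" if "a \<in> P" "x \<in> carrier (even_subring R)" for a x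
        using P that by (simp add: prime_in_def)
      show "a \<otimes>\<^bsub>even_subring R\<^esub> x \<in> P" if "a \<in> P" "x \<in> carrier (even_subring R)" for a x
        using P that even_commute[of a x] by (auto simp: prime_in_def)
    qed
    then show "primeideal P (even_subring R)"
      using P one_even by (intro primeidealI even_cring) (auto simp: prime_in_def)
  qed
qed

lemma ksdim0_finite_iff: "ksdim0 R < \<infinity> \<longleftrightarrow> (\<exists>d. dim_le (even_part R) d)"
proof
  let ?S = "{n::nat. \<exists>P :: nat \<Rightarrow> 'a set. (\<forall>i\<le>n. primeideal (P i) (even_subring R)) \<and> (\<forall>i<n. P i \<subset> P (Suc i))}"
  have k: "ksdim0 R = (SUP n \<in> ?S. ereal (real n))" by (simp add: ksdim0_def krull_dim_def)
  show "\<exists>d. dim_le (even_part R) d" if lt: "ksdim0 R < \<infinity>"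
  proof -
    \<comment> \<open>The value can also be -\<infinity>, when there are no primes; any natural
      number then serves as a bound.\<close>
    obtain d :: nat where d: "ksdim0 R \<le> ereal (real d)"
    proof (cases "ksdim0 R")
      case (real r)
      then show ?thesis using that[of "nat \<lceil>r\<rceil>"] by (simp add: of_nat_ceiling)
    qed (use lt that in auto)
    have "dim_le (even_part R) d"
    proof (rule dim_leI)
      fix n P assume "\<And>i. i \<le> n \<Longrightarrow> prime_in (even_part R) (P i)" "\<And>i. i < n \<Longrightarrow> P i \<subset> P (Suc i)"
      then have "n \<in> ?S" unfolding primeideal_iff by blast
      then have "ereal (real n) \<le> ksdim0 R" unfolding k by (rule SUP_upper)
      then show "n \<le> d" using d by (metis ereal_less_eq(3) of_nat_le_iff order_trans)
    qed
    then show ?thesis by blast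
  qed
  assume "\<exists>d. dim_le (even_part R) d"
  then obtain d where d: "dim_le (even_part R) d" by blast
  have "ksdim0 R \<le> ereal (real d)" unfolding k
    by (rule SUP_least) (use d in \<open>auto simp: dim_le_def primeideal_iff\<close>)
  then show "ksdim0 R < \<infinity>" by (auto simp: less_le_trans)
qed

lemma noeth_findim_carrier_iff: "noeth_findim (carrier R) \<longleftrightarrow> noetherian_super_ring R \<and> ksdim0 R < \<infinity>"
proof -
  have "carrier R \<inter> even_part R = even_part R" by auto
  then show ?thesis
    unfolding noeth_findim_def noetherian_iff ksdim0_finite_iff by (simp add: subsuper_ring_carrier)
qed

end


section \<open>Homomorphic images and finite generation\<close>

locale super_ring_hom = R?: super_ring R + S: super_ring S for R (structure) and S (structure) +
  fixes h
  assumes hom: "h \<in> ring_hom R S"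
    and hom_even: "x \<in> even_part R \<Longrightarrow> h x \<in> even_part S"
    and hom_odd: "x \<in> odd_part R \<Longrightarrow> h x \<in> odd_part S"
begin

sublocale ring_hom_ring R S h
  by (rule ring_hom_ringI2) (use hom R.ring_axioms S.ring_axioms in auto)

lemma hom_ev: "x \<in> carrier R \<Longrightarrow> S.ev (h x) = h (ev x)"
  using S.ev_od_sum(1)[of "h (ev x)" "h (od x)"] hom_even[of "ev x"] hom_odd[of "od x"]
    hom_add[of "ev x" "od x"] by (simp add: ev_od)

text \<open>Since h commutes with the parity projections, an even element h x equals h
  (\<open>ev x\<close>) and so has an even preimage.\<close>

lemma image_even: "h ` carrier R \<inter> even_part S = h ` even_part R"
proof
  show "h ` carrier R \<inter> even_part S \<subseteq> h ` even_part R"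
  proof
    fix y assume "y \<in> h ` carrier R \<inter> even_part S"
    then obtain x where x: "x \<in> carrier R" "y = h x" "h x \<in> even_part S" by auto
    then have "y = h (ev x)" using hom_ev S.ev_id by metis
    then show "y \<in> h ` even_part R" using x by simp
  qed
qed (use hom_even in auto)

lemma subsuper_ring_image: "S.subsuper_ring (h ` carrier R)"
  unfolding S.subsuper_ring_def
proof (intro conjI ballI S.additive_subgroup_closedI)
  show "\<zero>\<^bsub>S\<^esub> \<in> h ` carrier R" "\<one>\<^bsub>S\<^esub> \<in> h ` carrier R"
    using hom_zero hom_one by (metis R.zero_closed imageI, metis R.one_closed imageI)
  fix a assume "a \<in> h ` carrier R"
  then obtain x where x: "x \<in> carrier R" "a = h x" by auto
  show "\<ominus>\<^bsub>S\<^esub> a \<in> h ` carrier R" using x hom_a_inv[of x] by (metis R.a_inv_closed imageI)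
  show "S.ev a \<in> h ` carrier R" using x hom_ev[of x] by simp
  fix b assume "b \<in> h ` carrier R"
  then obtain y where y: "y \<in> carrier R" "b = h y" by auto
  show "a \<oplus>\<^bsub>S\<^esub> b \<in> h ` carrier R" using x y hom_add[of x y] by (metis R.a_closed imageI)
  show "a \<otimes>\<^bsub>S\<^esub> b \<in> h ` carrier R" using x y hom_mult[of x y] by (metis R.m_closed imageI)
qed auto

lemma asub_vimage:
  assumes "additive_subgroup J S" "additive_subgroup X R"
  shows "additive_subgroup {x \<in> X. h x \<in> J} R"
  using assms unfolding additive_subgroup_alt[OF R.ring_axioms] additive_subgroup_alt[OF S.ring_axioms]
  by (auto simp: subset_iff)

lemma graded_ideal_vimage:
  assumes J: "S.graded_ideal (h ` carrier R) J"
  shows "graded_ideal (carrier R) {x \<in> carrier R. h x \<in> J}"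
  unfolding graded_ideal_def
proof (intro conjI ballI)
  show "additive_subgroup {x \<in> carrier R. h x \<in> J} R"
    using asub_vimage S.graded_ideal_asub[OF J] subsuper_ring_asub[OF subsuper_ring_carrier] by blast
qed (use S.graded_ideal_l[OF J] S.graded_ideal_ev[OF J] in \<open>auto simp flip: hom_ev\<close>)

text \<open>An ideal of the image is recovered as the image of its preimage, so stabilization of the
  chain of preimages is enough.\<close>

lemma graded_noetherian_image:
  assumes "graded_noetherian (carrier R)"
  shows "S.graded_noetherian (h ` carrier R)"
  unfolding S.graded_noetherian_def
proof (intro allI impI, elim conjE)
  fix J :: "nat \<Rightarrow> _" assume J: "\<forall>n. S.graded_ideal (h ` carrier R) (J n)" "\<forall>n. J n \<subseteq> J (Suc n)"
  let ?J = "\<lambda>n. {x \<in> carrier R. h x \<in> J n}"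
  have "graded_ideal (carrier R) (?J n)" "?J n \<subseteq> ?J (Suc n)" for n using J graded_ideal_vimage by blast+
  then have "\<exists>N. \<forall>n\<ge>N. ?J n = ?J N" by (rule graded_noetherianD[where J = ?J, OF assms])
  then obtain N where N: "\<forall>n\<ge>N. ?J n = ?J N" ..
  have "J n = h ` ?J n" for n using S.graded_ideal_sub[OF J(1)[rule_format, of n]] by blast
  then have "J n = J N" if "n \<ge> N" for n using N[rule_format, OF that] by metis
  then show "\<exists>N. \<forall>n\<ge>N. J n = J N" by blast
qed

text \<open>Preimages of primes are primes, and strict inclusions stay strict because h maps the
  even part of R onto the even part of the image.\<close>

lemma dim_le_image:
  assumes dim: "dim_le (even_part R) d"
  shows "S.dim_le (h ` carrier R \<inter> even_part S) d"
  unfolding image_even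
proof (rule S.dim_leI)
  fix n P assume P: "\<And>i. i \<le> n \<Longrightarrow> S.prime_in (h ` even_part R) (P i)" and chain: "\<And>i. i < n \<Longrightarrow> P i \<subset> P (Suc i)"
  let ?Q = "\<lambda>i. {x \<in> even_part R. h x \<in> P i}"
  show "n \<le> d"
  proof (rule dim_leD[OF dim, of n ?Q])
    show "prime_in (even_part R) (?Q i)" if "i \<le> n" for i
    proof -
      note p = P[OF that]
      show ?thesis unfolding prime_in_def
      proof (intro conjI ballI impI)
        show "additive_subgroup (?Q i) R"
          using asub_vimage[OF S.prime_in_asub[OF p] even_asub] .
        show "a \<otimes> x \<in> ?Q i" if "a \<in> even_part R" "x \<in> ?Q i" for a x
          using that S.prime_in_l[OF p, of "h a" "h x"] even_even by simp
        show "\<one> \<notin> ?Q i" using S.prime_in_one[OF p] by simp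
        show "a \<in> ?Q i \<or> b \<in> ?Q i" if "a \<in> even_part R" "b \<in> even_part R" "a \<otimes> b \<in> ?Q i" for a b
          using that S.prime_in_prime[OF p, of "h a" "h b"] by auto
      qed auto
    qed
    show "?Q i \<subset> ?Q (Suc i)" if "i < n" for i
      using chain[OF that] S.prime_in_sub[OF P[of "Suc i"]] that by auto
  qed
qed

lemma noeth_findim_image:
  assumes "noeth_findim (carrier R)"
  shows "S.noeth_findim (h ` carrier R)"
proof -
  have e: "carrier R \<inter> even_part R = even_part R" by auto
  show ?thesis
    using assms subsuper_ring_image graded_noetherian_image dim_le_image unfolding noeth_findim_def S.noeth_findim_def e by blast
qed

end

section \<open>Finite generation of superideals\<close>

context super_ring
begin

inductive_set lspan :: "'a set \<Rightarrow> 'a set" for Y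
  where lspan_zero: "\<zero> \<in> lspan Y"
  | lspan_add: "\<lbrakk>v \<in> lspan Y; r \<in> carrier R; y \<in> Y\<rbrakk> \<Longrightarrow> v \<oplus> r \<otimes> y \<in> lspan Y"

text \<open>For homogeneous y the even component of r y is again a multiple of y, with coefficient
  \<open>ev r\<close> or \<open>od r\<close>; this is why generators are always taken
  homogeneous.\<close>

lemma lspan_graded_ideal:
  assumes Y: "Y \<subseteq> even_part R \<union> odd_part R"
  shows "graded_ideal (carrier R) (lspan Y)"
proof -
  have [simp]: "y \<in> carrier R" if "y \<in> Y" for y using that Y by auto
  have carr: "v \<in> carrier R" if "v \<in> lspan Y" for v
    using that by induction auto
  have add: "v \<oplus> w \<in> lspan Y" if "v \<in> lspan Y" "w \<in> lspan Y" for v w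
    using that(2)
  proof induction
    case lspan_zero
    then show ?case using that carr by simp
  next
    case (lspan_add w r y)
    then show ?case using lspan.lspan_add[of "v \<oplus> w" Y r y] that carr by (simp add: a_assoc)
  qed
  have mul: "a \<otimes> v \<in> lspan Y" if "v \<in> lspan Y" "a \<in> carrier R" for a v
    using that(1)
  proof induction
    case (lspan_add v r y)
    then show ?case using lspan.lspan_add[of "a \<otimes> v" Y "a \<otimes> r" y] that carr by (simp add: r_distr m_assoc)
  qed (use that lspan.lspan_zero in simp)
  have neg: "\<ominus> v \<in> lspan Y" if "v \<in> lspan Y" for v
    using mul[OF that, of "\<ominus> \<one>"] carr[OF that] by (simp add: l_minus)
  have "ev v \<in> lspan Y" if "v \<in> lspan Y" for v
    using that
  proof induction
    case lspan_zero
    then show ?case using lspan.lspan_zero by (simp add: ev_id)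
  next
    case (lspan_add v r y)
    then consider "y \<in> even_part R" | "y \<in> odd_part R" using Y by auto
    then have "\<exists>s\<in>carrier R. ev (r \<otimes> y) = s \<otimes> y"
    proof cases
      case 1
      then show ?thesis using ev_mult_even[of r y] lspan_add(2) by (intro bexI[of _ "ev r"]) auto
    next
      case 2
      then show ?thesis using ev_mult_odd[of r y] lspan_add(2) by (intro bexI[of _ "od r"]) auto
    qed
    then obtain s where "s \<in> carrier R" "ev (r \<otimes> y) = s \<otimes> y" by blast
    then show ?case using lspan_add lspan.lspan_add[of "ev v" Y s y] carr by (simp add: ev_add)
  qed
  then show ?thesis unfolding graded_ideal_def
    using carr mul add neg lspan_zero by (auto intro!: additive_subgroup_closedI)
qed

lemma lspan_base: "\<lbrakk>y \<in> Y; y \<in> carrier R\<rbrakk> \<Longrightarrow> y \<in> lspan Y"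
  using lspan_add[OF lspan_zero, of \<one> y Y] by simp

lemma lspan_mono: "Y \<subseteq> Y' \<Longrightarrow> lspan Y \<subseteq> lspan Y'"
proof
  fix v assume "Y \<subseteq> Y'" "v \<in> lspan Y"
  from this(2,1) show "v \<in> lspan Y'" by induction (auto intro: lspan.intros)
qed

text \<open>Otherwise an element of X outside the span could be added to any finite subset of X, and
  the spans would form a strictly ascending chain. The generators are chosen from X itself, so they
  keep its parity.\<close>

lemma finitely_generated:
  assumes noeth: "graded_noetherian (carrier R)" and X: "X \<subseteq> even_part R \<union> odd_part R"
  shows "\<exists>Y. finite Y \<and> Y \<subseteq> X \<and> X \<subseteq> lspan Y"
proof (rule ccontr)
  assume no: "\<not> ?thesis"
  then have "\<exists>x. x \<in> X \<and> x \<notin> lspan Y" if "finite Y" "Y \<subseteq> X" for Y using that by blast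
  then obtain f where f: "\<And>Y. finite Y \<Longrightarrow> Y \<subseteq> X \<Longrightarrow> f Y \<in> X \<and> f Y \<notin> lspan Y" by metis
  \<comment> \<open>\<open>f\<close> picks an element of X missing from the span of a finite subset;
    \<open>Y n\<close> collects the first n picks.\<close>
  define Y where "Y n = ((\<lambda>Y. insert (f Y) Y) ^^ n) {}" for n
  have Y_Suc: "Y (Suc n) = insert (f (Y n)) (Y n)" for n by (simp add: Y_def)
  have Y: "finite (Y n) \<and> Y n \<subseteq> X" for n
  proof (induction n)
    case (Suc n)
    then show ?case using f[of "Y n"] unfolding Y_Suc by simp
  qed (simp add: Y_def)
  have "graded_ideal (carrier R) (lspan (Y n))" for n
    using lspan_graded_ideal[of "Y n"] Y[of n] X by blast
  moreover have "lspan (Y n) \<subseteq> lspan (Y (Suc n))" for n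
    using lspan_mono[of "Y n" "Y (Suc n)"] Y_Suc[of n] by blast
  ultimately have "\<exists>N. \<forall>n\<ge>N. lspan (Y n) = lspan (Y N)"
    by (rule graded_noetherianD[where J = "\<lambda>n. lspan (Y n)", OF noeth])
  then obtain N where N: "\<forall>n\<ge>N. lspan (Y n) = lspan (Y N)" ..
  have "lspan (Y (Suc N)) = lspan (Y N)" by (rule N[rule_format]) simp
  moreover have "f (Y N) \<in> lspan (Y (Suc N))"
    using lspan_base[of "f (Y N)" "Y (Suc N)"] Y_Suc[of N] f[of "Y N"] Y[of N] X by auto
  ultimately show False using f[of "Y N"] Y[of N] by simp
qed

end


section \<open>The ring of finitely supported families\<close>

context ring
begin

lemma finsum_Sigma:
  assumes "finite A" "\<And>x. x \<in> A \<Longrightarrow> finite (B x)"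
    and "\<And>x y. x \<in> A \<Longrightarrow> y \<in> B x \<Longrightarrow> f x y \<in> carrier R"
  shows "(\<Oplus>x\<in>A. \<Oplus>y\<in>B x. f x y) = (\<Oplus>p\<in>Sigma A B. f (fst p) (snd p))"
  using assms
proof (induction A rule: finite_induct)
  case (insert x A)
  have S: "Sigma (insert x A) B = Pair x ` B x \<union> Sigma A B" by auto
  have "(\<Oplus>p\<in>Sigma (insert x A) B. f (fst p) (snd p))
    = (\<Oplus>p\<in>Pair x ` B x. f (fst p) (snd p)) \<oplus> (\<Oplus>p\<in>Sigma A B. f (fst p) (snd p))"
    unfolding S by (rule finsum_Un_disjoint) (use insert in \<open>auto intro!: finite_SigmaI\<close>)
  also have "(\<Oplus>p\<in>Pair x ` B x. f (fst p) (snd p)) = (\<Oplus>y\<in>B x. f x y)"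
    by (subst finsum_reindex) (use insert.prems in \<open>auto simp: inj_on_def\<close>)
  also have "(\<Oplus>p\<in>Sigma A B. f (fst p) (snd p)) = (\<Oplus>x\<in>A. \<Oplus>y\<in>B x. f x y)"
    using insert by simp
  finally show ?case
    by (subst finsum_insert) (use insert in \<open>auto intro!: finsum_closed\<close>)
qed simp

text \<open>The terms at (i, j) and (j, i) cancel and are removed together. The diagonal needs its
  own assumption, because x = -x does not force x = 0 when 2 is not cancellable. It serves to show
  that odd families have square zero.\<close>

lemma finsum_swap_cancel:
  assumes "finite D" and "\<And>i j. (i, j) \<in> D \<Longrightarrow> (j, i) \<in> D"
    and "\<And>i j. (i, j) \<in> D \<Longrightarrow> f i j \<in> carrier R"
    and "\<And>i j. (i, j) \<in> D \<Longrightarrow> f i j = \<ominus> f j i" and "\<And>i. (i, i) \<in> D \<Longrightarrow> f i i = \<zero>"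
  shows "(\<Oplus>p\<in>D. case p of (i, j) \<Rightarrow> f i j) = \<zero>"
  using assms
proof (induction D rule: finite_psubset_induct)
  case (psubset D)
  show ?case
  proof (cases "D = {}")
    case False
    then obtain i j where ij: "(i, j) \<in> D" by auto
    let ?D = "D - {(i, j), (j, i)}"
    have ji: "(j, i) \<in> D" using psubset.prems(1)[OF ij] .
    have fin: "finite ?D" using psubset.hyps by simp
    have c: "(\<lambda>(i, j). f i j) \<in> ?D \<rightarrow> carrier R" "f i j \<in> carrier R" "f j i \<in> carrier R"
      using psubset.prems(2) ij ji by auto
    have 0: "(\<Oplus>p\<in>?D. case p of (i, j) \<Rightarrow> f i j) = \<zero>"
    proof (rule psubset.IH)
      show "?D \<subset> D" using ij by auto
      show "(l, k) \<in> ?D" if "(k, l) \<in> ?D" for k l using psubset.prems(1) that by auto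
      show "f k l \<in> carrier R" if "(k, l) \<in> ?D" for k l using psubset.prems(2) that by auto
      show "f k l = \<ominus> f l k" if "(k, l) \<in> ?D" for k l
        by (rule psubset.prems(3)) (use that in auto)
      show "f k k = \<zero>" if "(k, k) \<in> ?D" for k using psubset.prems(4) that by auto
    qed
    show ?thesis
    proof (cases "i = j")
      case True
      then have D: "D = insert (i, i) ?D" using ij by auto
      show ?thesis
        by (subst D, subst finsum_insert) (use fin c 0 True psubset.prems(4) ij in auto)
    next
      case False
      then have D: "D = insert (i, j) (insert (j, i) ?D)" using ij ji by auto
      have "f i j \<oplus> f j i = \<zero>" using psubset.prems(3)[OF ij] c by (simp add: l_neg)
      then show ?thesis
        by (subst D) (use fin c 0 False in simp)
    qed
  qed simp
qed

lemma finsum_single: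
  assumes "finite D" "p \<in> D" "\<And>q. q \<in> D \<Longrightarrow> q \<noteq> p \<Longrightarrow> f q = \<zero>" "f p \<in> carrier R"
  shows "finsum R f D = f p"
proof -
  have D: "D = insert p (D - {p})" using assms by auto
  have z: "f \<in> D - {p} \<rightarrow> carrier R" using assms by auto
  have "finsum R f (D - {p}) = finsum R (\<lambda>_. \<zero>) (D - {p})"
    by (rule finsum_cong') (use assms in auto)
  then have "finsum R f (D - {p}) = \<zero>" by simp
  then show ?thesis
    by (subst D, subst finsum_insert) (use assms z in auto)
qed

end

context super_ring
begin

lemma asub_finsum:
  assumes X: "additive_subgroup X R" and f: "\<And>i. i \<in> D \<Longrightarrow> f i \<in> X"
  shows "finsum R f D \<in> X"
  using f
proof (induction D rule: infinite_finite_induct)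
  case (insert i D)
  then have "f \<in> D \<rightarrow> carrier R" "f i \<in> carrier R" using asub_carr[OF X] by auto
  then show ?case using insert asub_add[OF X] by simp
qed (use asub_zero[OF X] in simp_all)

lemma coset_eq_iff:
  assumes X: "additive_subgroup X R" and xy: "x \<in> carrier R" "y \<in> carrier R"
  shows "X +> x = X +> y \<longleftrightarrow> x \<ominus> y \<in> X"
proof -
  interpret abelian_subgroup X R
    by (rule abelian_subgroupI3) (use X is_abelian_group in auto)
  show ?thesis
    using xy a_rcos_module_minus[OF ring_axioms xy(2,1)] a_rcos_self a_repr_independence'
    by (metis)
qed

end

text \<open>Covers both rings at once: the degrees are natural numbers for the powers of I and pairs
  of them for the mixed powers. Finiteness of the decompositions of a degree makes the convolution a
  finite sum; the last two conditions make the product of classes independent of the representatives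
  on either side.\<close>

locale graded_family = super_ring R for R (structure) +
  fixes F G :: "'i::comm_monoid_add \<Rightarrow> 'a set"
  assumes finite_pairs: "finite {(i, j). i + j = (n::'i)}"
    and F: "graded_ideal (carrier R) (F i)" and G: "graded_ideal (carrier R) (G i)"
    and GF: "G i \<subseteq> F i" and F0: "F 0 = carrier R"
    and FF: "\<lbrakk>a \<in> F i; b \<in> F j\<rbrakk> \<Longrightarrow> a \<otimes> b \<in> F (i + j)"
    and FG: "\<lbrakk>a \<in> F i; b \<in> G j\<rbrakk> \<Longrightarrow> a \<otimes> b \<in> G (i + j)"
    and GF_mult: "\<lbrakk>a \<in> G i; b \<in> F j\<rbrakk> \<Longrightarrow> a \<otimes> b \<in> G (i + j)"
begin

abbreviation S :: "('i \<Rightarrow> 'a set) super_ring"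
  where "S \<equiv> graded_super_ring R F G"

definition pairs :: "'i \<Rightarrow> ('i \<times> 'i) set"
  where "pairs n = {(i, j). i + j = n}"

text \<open>Finitely supported families of representatives. Every element of \<open>S\<close> is
  \<open>cls\<close> of such a family, and the ring axioms are checked here before passing to
  classes.\<close>

definition fam :: "('i \<Rightarrow> 'a) set"
  where "fam = {a. (\<forall>i. a i \<in> F i) \<and> finite {i. a i \<noteq> \<zero>}}"

definition cls :: "('i \<Rightarrow> 'a) \<Rightarrow> 'i \<Rightarrow> 'a set"
  where "cls a = (\<lambda>i. G i +> a i)"

definition conv :: "('i \<Rightarrow> 'a) \<Rightarrow> ('i \<Rightarrow> 'a) \<Rightarrow> 'i \<Rightarrow> 'a"
  where "conv a b n = (\<Oplus>p\<in>pairs n. case p of (i, j) \<Rightarrow> a i \<otimes> b j)"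

definition mon :: "'i \<Rightarrow> 'a \<Rightarrow> 'i \<Rightarrow> 'a"
  where "mon i x = (\<lambda>j. if j = i then x else \<zero>)"

lemmas F_asub = graded_ideal_asub[OF F] and G_asub = graded_ideal_asub[OF G]

lemma fin [simp]: "finite (pairs n)"
  using finite_pairs by (simp add: pairs_def)

lemma pairs_iff [simp]: "(i, j) \<in> pairs n \<longleftrightarrow> i + j = n"
  by (simp add: pairs_def)

lemma F_carr [simp]: "x \<in> F i \<Longrightarrow> x \<in> carrier R"
  using asub_carr F_asub by blast

lemma G_carr: "x \<in> G i \<Longrightarrow> x \<in> carrier R"
  using asub_carr G_asub by blast

lemma fam_F: "a \<in> fam \<Longrightarrow> a i \<in> F i"
  and fam_fin: "a \<in> fam \<Longrightarrow> finite {i. a i \<noteq> \<zero>}"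
  by (simp_all add: fam_def)

lemma fam_carr [simp]: "a \<in> fam \<Longrightarrow> a i \<in> carrier R"
  using fam_F F_carr by blast

lemma abelian_subgroup_G: "abelian_subgroup (G i) R"
  by (rule abelian_subgroupI3) (use G_asub is_abelian_group in auto)

lemma coset_zero: "G i +> \<zero> = G i"
  using a_coset_add_zero additive_subgroup.a_subset G_asub by blast

lemma cls_eq_iff:
  assumes "\<And>i. a i \<in> carrier R" "\<And>i. b i \<in> carrier R"
  shows "cls a = cls b \<longleftrightarrow> (\<forall>i. a i \<ominus> b i \<in> G i)"
  using assms by (simp add: cls_def fun_eq_iff coset_eq_iff[OF G_asub])

lemma graded_sum_eq:
  assumes "\<zero> \<in> P"
  shows "graded_sum R F G P = cls ` {a \<in> fam. \<forall>i. a i \<in> P}"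
proof (intro equalityI subsetI)
  fix f assume f: "f \<in> graded_sum R F G P"
  then obtain a where a: "\<And>i. a i \<in> F i \<inter> P" "\<And>i. f i = G i +> a i"
    unfolding graded_sum_def mem_Collect_eq Bex_def by metis
  \<comment> \<open>A chosen representative of a zero class need not be 0; resetting it to 0 makes
    the support finite.\<close>
  define b where "b i = (if f i = G i then \<zero> else a i)" for i
  have "finite {i. f i \<noteq> G i}" using f by (simp add: graded_sum_def)
  then have "finite {i. b i \<noteq> \<zero>}" by (rule rev_finite_subset) (auto simp: b_def)
  then have "b \<in> {a \<in> fam. \<forall>i. a i \<in> P}"
    using a assms asub_zero F_asub by (auto simp: fam_def b_def)
  moreover have "f = cls b"
  proof
    fix i
    show "f i = cls b i"
      using a(2)[of i] by (cases "f i = G i") (simp_all add: cls_def b_def coset_zero)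
  qed
  ultimately show "f \<in> cls ` {a \<in> fam. \<forall>i. a i \<in> P}" by blast
next
  fix f assume "f \<in> cls ` {a \<in> fam. \<forall>i. a i \<in> P}"
  then obtain a where a: "a \<in> fam" "\<And>i. a i \<in> P" "f = cls a" by auto
  have "finite {i. f i \<noteq> G i}"
    by (rule rev_finite_subset[OF fam_fin[OF a(1)]]) (auto simp: a(3) cls_def coset_zero)
  then show "f \<in> graded_sum R F G P"
    using a fam_F unfolding graded_sum_def by (auto simp: cls_def)
qed

lemma carrier_S: "carrier S = cls ` fam"
  using graded_sum_eq[of "carrier R"] by (auto simp: graded_super_ring_def)

lemma even_S: "even_part S = cls ` {a \<in> fam. \<forall>i. a i \<in> even_part R}"
  and odd_S: "odd_part S = cls ` {a \<in> fam. \<forall>i. a i \<in> odd_part R}"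
  using graded_sum_eq[of "even_part R"] graded_sum_eq[of "odd_part R"]
  by (simp_all add: graded_super_ring_def)

lemma zero_S: "\<zero>\<^bsub>S\<^esub> = cls (\<lambda>_. \<zero>)"
  by (simp add: graded_super_ring_def cls_def coset_zero)

lemma one_S: "\<one>\<^bsub>S\<^esub> = cls (mon 0 \<one>)"
  by (auto simp add: graded_super_ring_def cls_def coset_zero mon_def fun_eq_iff)

lemma add_S:
  assumes "a \<in> fam" "b \<in> fam"
  shows "cls a \<oplus>\<^bsub>S\<^esub> cls b = cls (\<lambda>i. a i \<oplus> b i)"
  using assms abelian_subgroup.a_rcos_sum[OF abelian_subgroup_G]
  by (simp add: graded_super_ring_def cls_def FactRing_def)

text \<open>For a = g + x and b = h + y the difference a b - x y = g h + g y + x h lies in G (i +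
  j). So all cosets in the union defining \<open>rcoset_mult\<close> coincide, although the factors
  are cosets of different ideals.\<close>

lemma rcoset_mult_graded:
  assumes x: "x \<in> F i" and y: "y \<in> F j"
  shows "rcoset_mult R (G (i + j)) (G i +> x) (G j +> y) = G (i + j) +> (x \<otimes> y)"
proof -
  have [simp]: "x \<in> carrier R" "y \<in> carrier R" using x y by simp_all
  have eq: "G (i + j) +> (a \<otimes> b) = G (i + j) +> (x \<otimes> y)" if ab: "a \<in> G i +> x" "b \<in> G j +> y" for a b
  proof -
    obtain g h where gh: "g \<in> G i" "a = g \<oplus> x" "h \<in> G j" "b = h \<oplus> y"
      using ab by (auto simp: a_r_coset_def')
    have c: "g \<in> carrier R" "h \<in> carrier R" "x \<in> carrier R" "y \<in> carrier R"
      using gh G_carr by auto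
    have "a \<otimes> b \<ominus> x \<otimes> y = (g \<otimes> h \<oplus> g \<otimes> y) \<oplus> x \<otimes> h"
      unfolding gh using c by algebra
    moreover have "\<dots> \<in> G (i + j)"
      using gh x y GF FG GF_mult asub_add[OF G_asub] by (meson subsetD)
    ultimately show ?thesis
      using coset_eq_iff[OF G_asub, of "a \<otimes> b" "x \<otimes> y"] gh c by simp
  qed
  have "x \<in> G i +> x" "y \<in> G j +> y"
    using abelian_subgroup.a_rcos_self[OF abelian_subgroup_G] by simp_all
  then show ?thesis unfolding rcoset_mult_def using eq by blast
qed

lemma finsum_quot:
  assumes "finite D" "\<And>p. p \<in> D \<Longrightarrow> f p \<in> carrier R"
  shows "finsum (R Quot G n) (\<lambda>p. G n +> f p) D = G n +> finsum R f D"
proof -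
  have "ideal (G n) R" using G superideal_iff superideal.axioms(1) by blast
  then interpret Q: ring "R Quot G n" by (rule ideal.quotient_is_ring)
  have carr: "G n +> x \<in> carrier (R Quot G n)" if "x \<in> carrier R" for x
    using that a_rcosetsI[of "G n" x] G_carr by (auto simp: FactRing_def)
  show ?thesis using assms
  proof (induction D rule: finite_induct)
    case empty
    have "finsum (R Quot G n) (\<lambda>p. G n +> f p) {} = \<zero>\<^bsub>R Quot G n\<^esub>" by (rule Q.finsum_empty)
    then show ?case by (simp add: FactRing_def coset_zero)
  next
    case (insert p D)
    have "finsum (R Quot G n) (\<lambda>p. G n +> f p) (insert p D)
      = (G n +> f p) \<oplus>\<^bsub>R Quot G n\<^esub> (G n +> finsum R f D)"
      using insert carr by (subst Q.finsum_insert) auto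
    also have "\<dots> = G n +> (f p \<oplus> finsum R f D)"
      using insert.prems abelian_subgroup.a_rcos_sum[OF abelian_subgroup_G, of "f p" "finsum R f D"]
      by (auto simp: FactRing_def intro!: finsum_closed)
    finally show ?case using insert by (subst finsum_insert) auto
  qed
qed

lemma mult_S:
  assumes a: "a \<in> fam" and b: "b \<in> fam"
  shows "cls a \<otimes>\<^bsub>S\<^esub> cls b = cls (conv a b)"
proof
  fix n
  interpret Q: ring "R Quot G n"
    using G superideal_iff superideal.axioms(1) ideal.quotient_is_ring by blast
  have carr: "G n +> x \<in> carrier (R Quot G n)" if "x \<in> carrier R" for x
    using that a_rcosetsI[of "G n" x] G_carr by (auto simp: FactRing_def)
  have "(cls a \<otimes>\<^bsub>S\<^esub> cls b) n
    = finsum (R Quot G n) (\<lambda>(i, j). rcoset_mult R (G n) (G i +> a i) (G j +> b j)) (pairs n)"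
    by (simp add: graded_super_ring_def cls_def pairs_def)
  also have "\<dots> = finsum (R Quot G n) (\<lambda>p. G n +> (case p of (i, j) \<Rightarrow> a i \<otimes> b j)) (pairs n)"
    by (rule Q.finsum_cong')
      (use a b carr rcoset_mult_graded[OF fam_F[OF a] fam_F[OF b]] in \<open>auto\<close>)
  also have "\<dots> = G n +> conv a b n"
    unfolding conv_def by (rule finsum_quot) (use a b in auto)
  finally show "(cls a \<otimes>\<^bsub>S\<^esub> cls b) n = cls (conv a b) n" by (simp add: cls_def)
qed

section \<open>Families of representatives under addition and convolution\<close>

lemma fam_zero: "(\<lambda>_. \<zero>) \<in> fam"
  using asub_zero F_asub by (auto simp: fam_def)

lemma fam_mon: "x \<in> F i \<Longrightarrow> mon i x \<in> fam"
  using asub_zero F_asub by (auto simp: fam_def mon_def)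

lemma fam_add: "\<lbrakk>a \<in> fam; b \<in> fam\<rbrakk> \<Longrightarrow> (\<lambda>i. a i \<oplus> b i) \<in> fam"
  using asub_add F_asub fam_fin[of a] fam_fin[of b]
  by (auto simp: fam_def intro: finite_subset[of _ "{i. a i \<noteq> \<zero>} \<union> {i. b i \<noteq> \<zero>}"])

lemma fam_map:
  assumes "a \<in> fam" "\<And>i x. x \<in> F i \<Longrightarrow> f x \<in> F i" "f \<zero> = \<zero>"
  shows "(\<lambda>i. f (a i)) \<in> fam"
proof -
  have "finite {i. f (a i) \<noteq> \<zero>}"
    by (rule rev_finite_subset[OF fam_fin[OF assms(1)]]) (use assms(3) in auto)
  then show ?thesis using assms by (auto simp: fam_def)
qed

lemma fam_conv:
  assumes a: "a \<in> fam" and b: "b \<in> fam"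
  shows "conv a b \<in> fam"
proof -
  have "conv a b n \<in> F n" for n
    unfolding conv_def by (rule asub_finsum[OF F_asub]) (use FF fam_F a b in auto)
  moreover have "{n. conv a b n \<noteq> \<zero>} \<subseteq> (\<lambda>(i, j). i + j) ` ({i. a i \<noteq> \<zero>} \<times> {j. b j \<noteq> \<zero>})"
  proof
    fix n assume n: "n \<in> {n. conv a b n \<noteq> \<zero>}"
    show "n \<in> (\<lambda>(i, j). i + j) ` ({i. a i \<noteq> \<zero>} \<times> {j. b j \<noteq> \<zero>})"
    proof (rule ccontr)
      assume no: "\<not> ?thesis"
      have "conv a b n = (\<Oplus>p\<in>pairs n. \<zero>)"
        unfolding conv_def
      proof (rule finsum_cong')
        fix p assume p: "p \<in> pairs n"
        obtain i j where ij: "p = (i, j)" by (cases p)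
        then have "a i = \<zero> \<or> b j = \<zero>" using no p by force
        then show "(case p of (i, j) \<Rightarrow> a i \<otimes> b j) = \<zero>" using ij a b by auto
      qed auto
      then show False using n by simp
    qed
  qed
  then have "finite {n. conv a b n \<noteq> \<zero>}"
    by (rule finite_subset) (use fam_fin a b in simp)
  ultimately show ?thesis by (simp add: fam_def)
qed

lemma conv_add_l:
  assumes "a \<in> fam" "b \<in> fam" "c \<in> fam"
  shows "conv (\<lambda>i. a i \<oplus> b i) c = (\<lambda>i. conv a c i \<oplus> conv b c i)"
proof
  fix n
  have "(\<Oplus>p\<in>pairs n. case p of (i, j) \<Rightarrow> (a i \<oplus> b i) \<otimes> c j)
    = (\<Oplus>p\<in>pairs n. (case p of (i, j) \<Rightarrow> a i \<otimes> c j) \<oplus> (case p of (i, j) \<Rightarrow> b i \<otimes> c j))"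
    by (rule finsum_cong') (use assms in \<open>auto simp: l_distr\<close>)
  also have "\<dots> = conv a c n \<oplus> conv b c n"
    unfolding conv_def by (rule finsum_addf) (use assms in auto)
  finally show "conv (\<lambda>i. a i \<oplus> b i) c n = conv a c n \<oplus> conv b c n" by (simp add: conv_def)
qed

lemma conv_add_r:
  assumes "a \<in> fam" "b \<in> fam" "c \<in> fam"
  shows "conv c (\<lambda>i. a i \<oplus> b i) = (\<lambda>i. conv c a i \<oplus> conv c b i)"
proof
  fix n
  have "(\<Oplus>p\<in>pairs n. case p of (i, j) \<Rightarrow> c i \<otimes> (a j \<oplus> b j))
    = (\<Oplus>p\<in>pairs n. (case p of (i, j) \<Rightarrow> c i \<otimes> a j) \<oplus> (case p of (i, j) \<Rightarrow> c i \<otimes> b j))"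
    by (rule finsum_cong') (use assms in \<open>auto simp: r_distr\<close>)
  also have "\<dots> = conv c a n \<oplus> conv c b n"
    unfolding conv_def by (rule finsum_addf) (use assms in auto)
  finally show "conv c (\<lambda>i. a i \<oplus> b i) n = conv c a n \<oplus> conv c b n" by (simp add: conv_def)
qed

lemma conv_assoc:
  assumes a: "a \<in> fam" and b: "b \<in> fam" and c: "c \<in> fam"
  shows "conv (conv a b) c = conv a (conv b c)"
proof
  fix n
  define A where "A = Sigma (pairs n) (\<lambda>p. pairs (fst p))"
  define B where "B = Sigma (pairs n) (\<lambda>p. pairs (snd p))"
  \<comment> \<open>The rebracketing of indices: ((i + j, k), (i, j)) goes to ((i, j + k), (j, k)),
    which turns one double sum into the other.\<close>
  define h where "h = (\<lambda>q::('i \<times> 'i) \<times> ('i \<times> 'i). ((fst (snd q), snd (snd q) + snd (fst q)), (snd (snd q), snd (fst q))))"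
  have "conv (conv a b) c n = (\<Oplus>p\<in>pairs n. (\<Oplus>q\<in>pairs (fst p). (a (fst q) \<otimes> b (snd q)) \<otimes> c (snd p)))"
    unfolding conv_def
  proof (rule finsum_cong')
    fix p assume "p \<in> pairs n"
    show "(case p of (i, j) \<Rightarrow> (\<Oplus>p\<in>pairs i. case p of (i, j) \<Rightarrow> a i \<otimes> b j) \<otimes> c j)
      = (\<Oplus>q\<in>pairs (fst p). (a (fst q) \<otimes> b (snd q)) \<otimes> c (snd p))"
      by (auto simp: case_prod_beta intro!: finsum_ldistr) (use a b c in auto)
  qed (use a b c in \<open>auto intro!: finsum_closed\<close>)
  also have "\<dots> = (\<Oplus>q\<in>A. (a (fst (snd q)) \<otimes> b (snd (snd q))) \<otimes> c (snd (fst q)))"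
    unfolding A_def by (rule finsum_Sigma) (use a b c in auto)
  also have "\<dots> = (\<Oplus>q\<in>A. a (fst (fst (h q))) \<otimes> (b (fst (snd (h q))) \<otimes> c (snd (snd (h q)))))"
    by (rule finsum_cong') (use a b c in \<open>auto simp: h_def m_assoc\<close>)
  also have "\<dots> = (\<Oplus>q\<in>h ` A. a (fst (fst q)) \<otimes> (b (fst (snd q)) \<otimes> c (snd (snd q))))"
  proof (rule finsum_reindex[symmetric])
    show "inj_on h A" by (auto simp: inj_on_def h_def A_def)
  qed (use a b c in auto)
  also have "h ` A = B"
  proof
    show "h ` A \<subseteq> B" by (auto simp: h_def A_def B_def add.assoc)
    show "B \<subseteq> h ` A"
    proof
      fix q assume "q \<in> B"
      then obtain i m j k where q: "q = ((i, m), (j, k))" "i + m = n" "j + k = m" by (auto simp: B_def)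
      then have "((i + j, k), (i, j)) \<in> A" by (auto simp: A_def add.assoc)
      moreover have "h ((i + j, k), (i, j)) = q" using q by (simp add: h_def)
      ultimately show "q \<in> h ` A" by force
    qed
  qed
  also have "(\<Oplus>q\<in>B. a (fst (fst q)) \<otimes> (b (fst (snd q)) \<otimes> c (snd (snd q))))
    = (\<Oplus>p\<in>pairs n. (\<Oplus>q\<in>pairs (snd p). a (fst p) \<otimes> (b (fst q) \<otimes> c (snd q))))"
    unfolding B_def by (rule finsum_Sigma[symmetric]) (use a b c in auto)
  also have "\<dots> = conv a (conv b c) n"
    unfolding conv_def
  proof (rule finsum_cong')
    fix p assume "p \<in> pairs n"
    show "(\<Oplus>q\<in>pairs (snd p). a (fst p) \<otimes> (b (fst q) \<otimes> c (snd q)))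
      = (case p of (i, j) \<Rightarrow> a i \<otimes> (\<Oplus>p\<in>pairs j. case p of (i, j) \<Rightarrow> b i \<otimes> c j))"
      by (auto simp: case_prod_beta intro!: finsum_rdistr[symmetric]) (use a b c in auto)
  qed (use a b c in \<open>auto intro!: finsum_closed\<close>)
  finally show "conv (conv a b) c n = conv a (conv b c) n" .
qed

lemma conv_mon:
  assumes x: "x \<in> F i" and y: "y \<in> F j"
  shows "conv (mon i x) (mon j y) = mon (i + j) (x \<otimes> y)"
proof
  fix n
  have [simp]: "x \<in> carrier R" "y \<in> carrier R" using x y by simp_all
  show "conv (mon i x) (mon j y) n = mon (i + j) (x \<otimes> y) n"
  proof (cases "n = i + j")
    case True
    show ?thesis unfolding conv_def
      by (subst finsum_single[of _ "(i, j)"]) (use True in \<open>auto simp: mon_def split: if_splits\<close>)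
  next
    case False
    have "conv (mon i x) (mon j y) n = (\<Oplus>p\<in>pairs n. \<zero>)" unfolding conv_def
      by (rule finsum_cong') (use False in \<open>auto simp: mon_def split: if_splits\<close>)
    then show ?thesis using False by (simp add: mon_def)
  qed
qed

lemma conv_one_l:
  assumes a: "a \<in> fam"
  shows "conv (mon 0 \<one>) a = a"
proof
  fix n
  show "conv (mon 0 \<one>) a n = a n" unfolding conv_def
    by (subst finsum_single[of _ "(0, n)"]) (use a in \<open>auto simp: mon_def split: if_splits\<close>)
qed

lemma conv_one_r:
  assumes a: "a \<in> fam"
  shows "conv a (mon 0 \<one>) = a"
proof
  fix n
  show "conv a (mon 0 \<one>) n = a n" unfolding conv_def
    by (subst finsum_single[of _ "(n, 0)"]) (use a in \<open>auto simp: mon_def split: if_splits\<close>)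
qed

lemma conv_swap:
  assumes a: "a \<in> fam" and b: "b \<in> fam"
  shows "(\<Oplus>p\<in>pairs n. case p of (i, j) \<Rightarrow> b j \<otimes> a i) = conv b a n"
proof -
  have swap: "prod.swap ` pairs n = pairs n" by (auto simp: pairs_def add.commute image_iff)
  have "(\<Oplus>p\<in>prod.swap ` pairs n. case p of (i, j) \<Rightarrow> b i \<otimes> a j) = (\<Oplus>p\<in>pairs n. case prod.swap p of (i, j) \<Rightarrow> b i \<otimes> a j)"
    by (rule finsum_reindex) (use a b in \<open>auto\<close>)
  then show ?thesis unfolding swap conv_def by (simp add: case_prod_unfold)
qed

end


section \<open>The graded super-ring of a multiplicative family of superideals\<close>

context graded_family
begin

lemma cls_in_S: "a \<in> fam \<Longrightarrow> cls a \<in> carrier S"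
  by (auto simp: carrier_S)

lemma S_cases:
  assumes "f \<in> carrier S"
  obtains a where "a \<in> fam" "f = cls a"
  using assms by (auto simp: carrier_S)

lemma even_S_cases:
  assumes "f \<in> even_part S"
  obtains a where "a \<in> fam" "\<And>i. a i \<in> even_part R" "f = cls a"
  using assms by (auto simp: even_S)

lemma odd_S_cases:
  assumes "f \<in> odd_part S"
  obtains a where "a \<in> fam" "\<And>i. a i \<in> odd_part R" "f = cls a"
  using assms by (auto simp: odd_S)

lemma fam_neg: "a \<in> fam \<Longrightarrow> (\<lambda>i. \<ominus> a i) \<in> fam"
  by (rule fam_map) (use asub_neg F_asub in auto)

lemma abelian_group_S: "abelian_group S"
proof (rule abelian_groupI)
  fix f assume "f \<in> carrier S"
  then obtain a where a: "a \<in> fam" "f = cls a" by (rule S_cases)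
  show "\<zero>\<^bsub>S\<^esub> \<oplus>\<^bsub>S\<^esub> f = f"
    using a by (simp add: zero_S add_S fam_zero)
  show "\<exists>g\<in>carrier S. g \<oplus>\<^bsub>S\<^esub> f = \<zero>\<^bsub>S\<^esub>"
    using a by (intro bexI[of _ "cls (\<lambda>i. \<ominus> a i)"])
      (simp_all add: zero_S add_S fam_neg cls_in_S l_neg)
  fix g assume "g \<in> carrier S"
  then obtain b where b: "b \<in> fam" "g = cls b" by (rule S_cases)
  show "f \<oplus>\<^bsub>S\<^esub> g \<in> carrier S" using a b by (simp add: add_S fam_add cls_in_S)
  show "f \<oplus>\<^bsub>S\<^esub> g = g \<oplus>\<^bsub>S\<^esub> f" using a b by (simp add: add_S a_comm)
  fix k assume "k \<in> carrier S"
  then obtain c where c: "c \<in> fam" "k = cls c" by (rule S_cases)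
  show "f \<oplus>\<^bsub>S\<^esub> g \<oplus>\<^bsub>S\<^esub> k = f \<oplus>\<^bsub>S\<^esub> (g \<oplus>\<^bsub>S\<^esub> k)"
    using a b c by (simp add: add_S fam_add a_assoc)
qed (simp add: zero_S fam_zero cls_in_S)

lemma fam_one: "mon 0 \<one> \<in> fam"
  by (rule fam_mon) (simp add: F0)

lemma ring_S: "ring S"
proof (rule ringI)
  show "abelian_group S" by (rule abelian_group_S)
  show "monoid S"
  proof (rule monoidI)
    fix f assume "f \<in> carrier S"
    then obtain a where a: "a \<in> fam" "f = cls a" by (rule S_cases)
    show "\<one>\<^bsub>S\<^esub> \<otimes>\<^bsub>S\<^esub> f = f" "f \<otimes>\<^bsub>S\<^esub> \<one>\<^bsub>S\<^esub> = f"
      using a by (simp_all add: one_S mult_S fam_one conv_one_l conv_one_r)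
    fix g assume "g \<in> carrier S"
    then obtain b where b: "b \<in> fam" "g = cls b" by (rule S_cases)
    show "f \<otimes>\<^bsub>S\<^esub> g \<in> carrier S" using a b by (simp add: mult_S fam_conv cls_in_S)
    fix k assume "k \<in> carrier S"
    then obtain c where c: "c \<in> fam" "k = cls c" by (rule S_cases)
    show "f \<otimes>\<^bsub>S\<^esub> g \<otimes>\<^bsub>S\<^esub> k = f \<otimes>\<^bsub>S\<^esub> (g \<otimes>\<^bsub>S\<^esub> k)"
      using a b c by (simp add: mult_S fam_conv conv_assoc)
  qed (simp add: one_S fam_one cls_in_S)
  fix f g k assume "f \<in> carrier S" "g \<in> carrier S" "k \<in> carrier S"
  then obtain a b c where "a \<in> fam" "f = cls a" "b \<in> fam" "g = cls b" "c \<in> fam" "k = cls c"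
    by (metis S_cases)
  then show "(f \<oplus>\<^bsub>S\<^esub> g) \<otimes>\<^bsub>S\<^esub> k = f \<otimes>\<^bsub>S\<^esub> k \<oplus>\<^bsub>S\<^esub> g \<otimes>\<^bsub>S\<^esub> k"
    "k \<otimes>\<^bsub>S\<^esub> (f \<oplus>\<^bsub>S\<^esub> g) = k \<otimes>\<^bsub>S\<^esub> f \<oplus>\<^bsub>S\<^esub> k \<otimes>\<^bsub>S\<^esub> g"
    by (simp_all add: add_S mult_S fam_conv fam_add conv_add_l conv_add_r)
qed

lemma neg_S:
  assumes "a \<in> fam"
  shows "\<ominus>\<^bsub>S\<^esub> cls a = cls (\<lambda>i. \<ominus> a i)"
proof -
  interpret S: ring S by (rule ring_S)
  show ?thesis
    by (rule S.minus_equality)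
      (use assms in \<open>simp_all add: add_S fam_neg cls_in_S zero_S l_neg\<close>)
qed

lemma asub_S:
  assumes "additive_subgroup P R"
  shows "additive_subgroup (cls ` {a \<in> fam. \<forall>i. a i \<in> P}) S"
  unfolding additive_subgroup_alt[OF ring_S]
  by (auto simp: cls_in_S zero_S add_S neg_S fam_zero fam_add fam_neg
      intro!: imageI asub_zero[OF assms] asub_add[OF assms] asub_neg[OF assms])

lemma conv_mem:
  assumes "a \<in> fam" "b \<in> fam" "additive_subgroup P R" "\<And>i j. a i \<otimes> b j \<in> P"
  shows "conv a b n \<in> P"
  unfolding conv_def by (rule asub_finsum) (use assms in auto)

lemma conv_commute:
  assumes "a \<in> fam" "b \<in> fam" "\<And>i j. a i \<otimes> b j = b j \<otimes> a i"
  shows "conv a b = conv b a"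
  using conv_swap[OF assms(1,2)] assms(3) by (auto simp: conv_def fun_eq_iff)

lemma conv_anticommute:
  assumes "a \<in> fam" "b \<in> fam" "\<And>i j. a i \<otimes> b j = \<ominus> (b j \<otimes> a i)"
  shows "conv a b = (\<lambda>n. \<ominus> conv b a n)"
proof
  fix n
  have e: "conv b a n = (\<Oplus>p\<in>pairs n. case p of (i, j) \<Rightarrow> b j \<otimes> a i)"
    by (rule conv_swap[OF assms(1,2), symmetric])
  have "conv a b n \<oplus> conv b a n = (\<Oplus>p\<in>pairs n. (case p of (i, j) \<Rightarrow> a i \<otimes> b j) \<oplus> (case p of (i, j) \<Rightarrow> b j \<otimes> a i))"
    unfolding e conv_def[of a b]
    by (rule finsum_addf[symmetric]) (use assms(1,2) in auto)
  also have "\<dots> = (\<Oplus>p\<in>pairs n. \<zero>)"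
    by (rule finsum_cong') (use assms in \<open>auto simp: l_neg\<close>)
  finally have "conv a b n \<oplus> conv b a n = \<zero>" by simp
  then show "conv a b n = \<ominus> conv b a n"
    using minus_equality[of "conv a b n" "conv b a n"] fam_conv assms(1,2) by simp
qed

lemma super_ring_S: "super_ring S"
proof (intro super_ring.intro super_ring_axioms.intro)
  interpret S: ring S by (rule ring_S)
  show "ring S" by (rule ring_S)
  show "subgroup (even_part S) (add_monoid S)" "subgroup (odd_part S) (add_monoid S)"
    unfolding even_S odd_S using asub_S even_asub odd_asub additive_subgroup.a_subgroup by blast+
  show "carrier S = even_part S <+>\<^bsub>S\<^esub> odd_part S"
  proof
    show "carrier S \<subseteq> even_part S <+>\<^bsub>S\<^esub> odd_part S"
    proof
      fix f assume "f \<in> carrier S"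
      then obtain a where a: "a \<in> fam" "f = cls a" by (rule S_cases)
      have e: "(\<lambda>i. ev (a i)) \<in> fam"
        by (rule fam_map[OF a(1)]) (use graded_ideal_ev[OF F] in \<open>auto simp: ev_id\<close>)
      have d: "(\<lambda>i. od (a i)) \<in> fam"
        by (rule fam_map[OF a(1)]) (use graded_ideal_od[OF F] in \<open>auto simp: od_0\<close>)
      have "f = cls (\<lambda>i. ev (a i)) \<oplus>\<^bsub>S\<^esub> cls (\<lambda>i. od (a i))"
        using a e d by (simp add: add_S ev_od)
      moreover have "cls (\<lambda>i. ev (a i)) \<in> even_part S" "cls (\<lambda>i. od (a i)) \<in> odd_part S"
        using a e d by (auto simp: even_S odd_S)
      ultimately show "f \<in> even_part S <+>\<^bsub>S\<^esub> odd_part S" by (auto simp: set_add_def')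
    qed
    show "even_part S <+>\<^bsub>S\<^esub> odd_part S \<subseteq> carrier S"
      by (auto simp: set_add_def' even_S odd_S cls_in_S)
  qed
  show "even_part S \<inter> odd_part S = {\<zero>\<^bsub>S\<^esub>}"
  proof
    show "even_part S \<inter> odd_part S \<subseteq> {\<zero>\<^bsub>S\<^esub>}"
    proof
      fix f assume f: "f \<in> even_part S \<inter> odd_part S"
      then obtain a where a: "a \<in> fam" "\<And>i. a i \<in> even_part R" "f = cls a"
        using even_S_cases by blast
      obtain b where b: "b \<in> fam" "\<And>i. b i \<in> odd_part R" "f = cls b"
        using odd_S_cases f by blast
      \<comment> \<open>An even and an odd representative of one class differ by an element of G i.
        As G i is graded, it contains the even component of the difference, which is a i, and so the
        class is zero.\<close>
      have "a i \<in> G i" for i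
      proof -
        have "a i \<ominus> b i \<in> G i" using cls_eq_iff[of a b] a b by simp
        then have "ev (a i \<oplus> \<ominus> b i) \<in> G i" using graded_ideal_ev[OF G] by (simp add: minus_eq)
        then show ?thesis using ev_od_sum(1)[of "a i" "\<ominus> b i"] a(2) asub_neg[OF odd_asub b(2)] by simp
      qed
      then have "f = cls (\<lambda>_. \<zero>)"
        unfolding a(3) using cls_eq_iff[of a "\<lambda>_. \<zero>"] a(1) by (simp add: minus_eq)
      then show "f \<in> {\<zero>\<^bsub>S\<^esub>}" by (simp add: zero_S)
    qed
    show "{\<zero>\<^bsub>S\<^esub>} \<subseteq> even_part S \<inter> odd_part S"
      using fam_zero by (auto simp: zero_S even_S odd_S)
  qed
  fix f g
  show "f \<otimes>\<^bsub>S\<^esub> g \<in> even_part S" if fg: "f \<in> even_part S" "g \<in> even_part S"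
  proof -
    obtain a where a: "a \<in> fam" "\<And>i. a i \<in> even_part R" "f = cls a" using even_S_cases[OF fg(1)] by metis
    obtain b where b: "b \<in> fam" "\<And>i. b i \<in> even_part R" "g = cls b" using even_S_cases[OF fg(2)] by metis
    show ?thesis unfolding even_S a(3) b(3) mult_S[OF a(1) b(1)]
      using fam_conv[OF a(1) b(1)] conv_mem[OF a(1) b(1) even_asub even_even[OF a(2) b(2)]] by blast
  qed
  show "f \<otimes>\<^bsub>S\<^esub> g \<in> odd_part S" if fg: "f \<in> even_part S" "g \<in> odd_part S"
  proof -
    obtain a where a: "a \<in> fam" "\<And>i. a i \<in> even_part R" "f = cls a" using even_S_cases[OF fg(1)] by metis
    obtain b where b: "b \<in> fam" "\<And>i. b i \<in> odd_part R" "g = cls b" using odd_S_cases[OF fg(2)] by metis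
    show ?thesis unfolding odd_S a(3) b(3) mult_S[OF a(1) b(1)]
      using fam_conv[OF a(1) b(1)] conv_mem[OF a(1) b(1) odd_asub even_odd[OF a(2) b(2)]] by blast
  qed
  show "f \<otimes>\<^bsub>S\<^esub> g \<in> odd_part S" if fg: "f \<in> odd_part S" "g \<in> even_part S"
  proof -
    obtain a where a: "a \<in> fam" "\<And>i. a i \<in> odd_part R" "f = cls a" using odd_S_cases[OF fg(1)] by metis
    obtain b where b: "b \<in> fam" "\<And>i. b i \<in> even_part R" "g = cls b" using even_S_cases[OF fg(2)] by metis
    show ?thesis unfolding odd_S a(3) b(3) mult_S[OF a(1) b(1)]
      using fam_conv[OF a(1) b(1)] conv_mem[OF a(1) b(1) odd_asub odd_even[OF a(2) b(2)]] by blast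
  qed
  show "f \<otimes>\<^bsub>S\<^esub> g \<in> even_part S" if fg: "f \<in> odd_part S" "g \<in> odd_part S"
  proof -
    obtain a where a: "a \<in> fam" "\<And>i. a i \<in> odd_part R" "f = cls a" using odd_S_cases[OF fg(1)] by metis
    obtain b where b: "b \<in> fam" "\<And>i. b i \<in> odd_part R" "g = cls b" using odd_S_cases[OF fg(2)] by metis
    show ?thesis unfolding even_S a(3) b(3) mult_S[OF a(1) b(1)]
      using fam_conv[OF a(1) b(1)] conv_mem[OF a(1) b(1) even_asub odd_odd[OF a(2) b(2)]] by blast
  qed
  show "f \<otimes>\<^bsub>S\<^esub> g = g \<otimes>\<^bsub>S\<^esub> f" if fg: "f \<in> even_part S" "g \<in> even_part S \<union> odd_part S"
  proof -
    obtain a where a: "a \<in> fam" "\<And>i. a i \<in> even_part R" "f = cls a" using even_S_cases[OF fg(1)] by metis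
    obtain b where b: "b \<in> fam" "\<And>i. b i \<in> even_part R \<union> odd_part R" "g = cls b"
      using fg(2) by (auto elim: even_S_cases odd_S_cases)
    show ?thesis unfolding a(3) b(3) mult_S[OF a(1) b(1)] mult_S[OF b(1) a(1)]
      using conv_commute[OF a(1) b(1) even_commute[OF a(2) b(2)]] by simp
  qed
  show "f \<otimes>\<^bsub>S\<^esub> g = \<ominus>\<^bsub>S\<^esub> (g \<otimes>\<^bsub>S\<^esub> f)" if fg: "f \<in> odd_part S" "g \<in> odd_part S"
  proof -
    obtain a where a: "a \<in> fam" "\<And>i. a i \<in> odd_part R" "f = cls a" using odd_S_cases[OF fg(1)] by metis
    obtain b where b: "b \<in> fam" "\<And>i. b i \<in> odd_part R" "g = cls b" using odd_S_cases[OF fg(2)] by metis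
    show ?thesis
      unfolding a(3) b(3) mult_S[OF a(1) b(1)] mult_S[OF b(1) a(1)] neg_S[OF fam_conv[OF b(1) a(1)]]
      using conv_anticommute[OF a(1) b(1) odd_anticommute[OF a(2) b(2)]] by simp
  qed
  show "f \<otimes>\<^bsub>S\<^esub> f = \<zero>\<^bsub>S\<^esub>" if f: "f \<in> odd_part S"
  proof -
    obtain a where a: "a \<in> fam" "\<And>i. a i \<in> odd_part R" "f = cls a" using odd_S_cases[OF f] by metis
    \<comment> \<open>Off the diagonal the terms cancel in pairs by anticommutativity; on it they
      are squares of odd elements.\<close>
    have "conv a a n = \<zero>" for n
      unfolding conv_def
    proof (rule finsum_swap_cancel[OF fin])
      show "a i \<otimes> a j = \<ominus> (a j \<otimes> a i)" for i j by (rule odd_anticommute[OF a(2) a(2)])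
      show "a i \<otimes> a i = \<zero>" for i by (rule odd_square[OF a(2)])
    qed (use a(1) in \<open>simp_all add: add.commute\<close>)
    then show ?thesis unfolding a(3) mult_S[OF a(1) a(1)] zero_S by (simp add: cls_def)
  qed
qed

sublocale S: super_ring S
  by (rule super_ring_S)

section \<open>Homogeneous elements and generation over degree 0\<close>

abbreviation hmon :: "'i \<Rightarrow> 'a \<Rightarrow> 'i \<Rightarrow> 'a set"
  where "hmon i x \<equiv> cls (mon i x)"

lemma hmon_add:
  assumes "x \<in> F i" "y \<in> F i"
  shows "hmon i (x \<oplus> y) = hmon i x \<oplus>\<^bsub>S\<^esub> hmon i y"
proof -
  have "mon i (x \<oplus> y) = (\<lambda>j. mon i x j \<oplus> mon i y j)" by (auto simp: mon_def)
  then show ?thesis using assms by (simp add: add_S fam_mon)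
qed

lemma hmon_mult:
  "\<lbrakk>x \<in> F i; y \<in> F j\<rbrakk> \<Longrightarrow> hmon (i + j) (x \<otimes> y) = hmon i x \<otimes>\<^bsub>S\<^esub> hmon j y"
  by (simp add: mult_S fam_mon conv_mon)

lemma hmon_parity:
  assumes "x \<in> F i"
  shows "x \<in> even_part R \<Longrightarrow> hmon i x \<in> even_part S" "x \<in> odd_part R \<Longrightarrow> hmon i x \<in> odd_part S"
  using fam_mon[OF assms] by (auto simp: even_S odd_S mon_def)

text \<open>As F 0 is all of R, the image of this map is the whole component of degree 0, which
  thereby inherits the finiteness properties of R.\<close>

lemma hmon_zero_hom: "super_ring_hom R S (hmon 0)"
proof (intro super_ring_hom.intro super_ring_hom_axioms.intro super_ring_axioms super_ring_S)
  show "hmon 0 \<in> ring_hom R S"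
    by (rule ring_hom_memI) (use hmon_mult[of _ 0 _ 0] in \<open>simp_all add: F0 cls_in_S fam_mon hmon_add one_S\<close>)
qed (use hmon_parity[of _ 0] F0 in auto)

text \<open>A finitely supported family is a finite sum of its homogeneous components; the induction
  runs over a finite set containing the support and splits off one component at a time.\<close>

lemma carrier_S_subset:
  assumes B: "additive_subgroup B S" and gen: "\<And>i x. x \<in> F i \<Longrightarrow> hmon i x \<in> B"
  shows "carrier S \<subseteq> B"
proof
  fix f assume "f \<in> carrier S"
  then obtain a where a: "a \<in> fam" "f = cls a" by (rule S_cases)
  have "cls a \<in> B" if "finite D" "a \<in> fam" "{i. a i \<noteq> \<zero>} \<subseteq> D" for a D
    using that
  proof (induction D arbitrary: a rule: finite_induct)
    case empty
    then have "a = (\<lambda>_. \<zero>)" by auto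
    then show ?case using S.asub_zero[OF B] by (simp add: zero_S)
  next
    case (insert i D)
    let ?b = "\<lambda>j. if j = i then \<zero> else a j"
    have "finite {j. ?b j \<noteq> \<zero>}" by (rule rev_finite_subset[OF fam_fin[OF insert.prems(1)]]) auto
    then have b: "?b \<in> fam" using insert.prems(1) asub_zero[OF F_asub] by (simp add: fam_def)
    then have "cls ?b \<in> B" by (rule insert.IH) (use insert.prems in auto)
    moreover have "a = (\<lambda>j. ?b j \<oplus> mon i (a i) j)" using insert.prems(1) by (auto simp: mon_def)
    then have "cls a = cls ?b \<oplus>\<^bsub>S\<^esub> hmon i (a i)"
      using add_S[OF b fam_mon[OF fam_F[OF insert.prems(1)]]] by simp
    ultimately show ?case using S.asub_add[OF B] gen[OF fam_F[OF insert.prems(1)]] by simp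
  qed
  then show "f \<in> B" using a fam_fin by blast
qed

text \<open>The assumption \<open>gen\<close> says that the components \<open>F i\<close> are generated, as a graded algebra
  over \<open>F 0\<close>, by the finitely many homogeneous elements listed in \<open>Z\<close>.\<close>

theorem finitely_generated_noeth_findim:
  assumes R: "noetherian_super_ring R" "ksdim0 R < \<infinity>"
    and Z: "finite Z" "\<And>i z. (i, z) \<in> Z \<Longrightarrow> z \<in> F i \<and> z \<in> even_part R \<union> odd_part R"
    and gen: "\<And>H i. \<lbrakk>\<And>i. additive_subgroup (H i) R; H 0 = carrier R; \<And>i z. (i, z) \<in> Z \<Longrightarrow> z \<in> H i;
      \<And>i j x y. \<lbrakk>x \<in> H i; y \<in> H j\<rbrakk> \<Longrightarrow> x \<otimes> y \<in> H (i + j)\<rbrakk> \<Longrightarrow> F i \<subseteq> H i"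
  shows "noetherian_super_ring S \<and> ksdim0 S < \<infinity>"
proof -
  interpret h: super_ring_hom R S "hmon 0" by (rule hmon_zero_hom)
  have "noeth_findim (carrier R)" using R noeth_findim_carrier_iff by blast
  then have "S.noeth_findim (hmon 0 ` carrier R)" by (rule h.noeth_findim_image)
  moreover have "(\<lambda>(i, z). hmon i z) ` Z \<subseteq> even_part S \<union> odd_part S"
    using hmon_parity Z(2) by fast
  ultimately obtain B where B: "S.noeth_findim B" "hmon 0 ` carrier R \<subseteq> B" "(\<lambda>(i, z). hmon i z) ` Z \<subseteq> B"
    using S.noeth_findim_adjoin_finite[of "(\<lambda>(i, z). hmon i z) ` Z"] Z(1) by blast
  have Bs: "S.subsuper_ring B" using B(1) by (simp add: S.noeth_findim_def)
  note Ba = S.subsuper_ring_asub[OF Bs]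
  have mzero: "hmon i \<zero> \<in> B" for i
  proof -
    have "mon i \<zero> = (\<lambda>_. \<zero>)" by (auto simp: mon_def)
    then show ?thesis using S.asub_zero[OF Ba] by (simp add: zero_S)
  qed
  \<comment> \<open>The elements whose class lies in B form a multiplicative family containing R in
    degree 0 and the generators, so \<open>gen\<close> applies with this family as H.\<close>
  have "F i \<subseteq> {x \<in> F i. hmon i x \<in> B}" for i
  proof (rule gen)
    fix i
    show "additive_subgroup {x \<in> F i. hmon i x \<in> B} R"
    proof (rule additive_subgroup_closedI)
      fix a assume a: "a \<in> {x \<in> F i. hmon i x \<in> B}"
      have "(\<lambda>j. \<ominus> mon i a j) = mon i (\<ominus> a)" by (auto simp: mon_def)
      then have "\<ominus>\<^bsub>S\<^esub> hmon i a = hmon i (\<ominus> a)" using neg_S[OF fam_mon] a by simp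
      then show "\<ominus> a \<in> {x \<in> F i. hmon i x \<in> B}"
        using a S.asub_neg[OF Ba, of "hmon i a"] asub_neg[OF F_asub] by simp
      fix b assume b: "b \<in> {x \<in> F i. hmon i x \<in> B}"
      show "a \<oplus> b \<in> {x \<in> F i. hmon i x \<in> B}"
        using a b hmon_add[of a i b] S.asub_add[OF Ba] asub_add[OF F_asub] by simp
    qed (use mzero asub_zero[OF F_asub] in auto)
    show "{x \<in> F 0. hmon 0 x \<in> B} = carrier R" using B(2) F0 by auto
    show "z \<in> {x \<in> F i. hmon i x \<in> B}" if "(i, z) \<in> Z" for z
      using that Z(2) B(3) by force
    show "x \<otimes> y \<in> {x \<in> F (i + j). hmon (i + j) x \<in> B}"
      if "x \<in> {x \<in> F i. hmon i x \<in> B}" "y \<in> {x \<in> F j. hmon j x \<in> B}" for j x y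
      using that FF[of x i y j] hmon_mult[of x i y j] S.subsuper_ring_mult[OF Bs] by simp
  qed
  then have "carrier S \<subseteq> B" using carrier_S_subset[OF Ba] by blast
  then have "B = carrier S" using S.asub_carr[OF Ba] by blast
  then show ?thesis using B(1) S.noeth_findim_carrier_iff by simp
qed

end


section \<open>The associated graded super-rings\<close>

context super_ring
begin

text \<open>X is not assumed to absorb multiplication, as it may be the even or odd part of I. A
  homogeneous z is moved past x instead, z x j = x' (z j) with x' in X, and is absorbed by
  J.\<close>

lemma graded_ideal_ideal_prod:
  assumes X: "additive_subgroup X R" "\<And>x. x \<in> X \<Longrightarrow> ev x \<in> X" and J: "graded_ideal (carrier R) J"
  shows "graded_ideal (carrier R) (X \<cdot> J)"
proof -
  have Xc [simp]: "x \<in> carrier R" if "x \<in> X" for x using asub_carr[OF X(1)] that .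
  have Jc [simp]: "j \<in> carrier R" if "j \<in> J" for j using asub_carr[OF graded_ideal_asub[OF J]] that .
  have Xod: "od x \<in> X" if "x \<in> X" for x using asub_diff[OF X(1) that X(2)[OF that]] by (simp add: od_def)
  have carr: "s \<in> carrier R" if "s \<in> X \<cdot> J" for s
    using that by induction auto
  have hom: "z \<otimes> s \<in> X \<cdot> J" if s: "s \<in> X \<cdot> J" and z: "z \<in> even_part R \<union> odd_part R" for s z
    using s
  proof induction
    case (prod x j)
    obtain x' where x': "x' \<in> X" "z \<otimes> x = x' \<otimes> z" using homog_twist(1)[OF X z prod(1)] by blast
    have [simp]: "z \<in> carrier R" using z by auto
    have "z \<otimes> (x \<otimes> j) = (z \<otimes> x) \<otimes> j" using prod by (simp add: m_assoc)
    also have "\<dots> = x' \<otimes> (z \<otimes> j)" using prod x' by (simp add: m_assoc)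
    finally show ?case using ideal_prod.prod[of x' X "z \<otimes> j" J R] x' graded_ideal_l[OF J _ prod(2)] by simp
  next
    case (sum s t)
    have "z \<in> carrier R" using z by auto
    then show ?case using sum carr ideal_prod.sum[OF sum(3,4)] by (simp add: r_distr)
  qed
  have "ev s \<in> X \<cdot> J" if "s \<in> X \<cdot> J" for s
    using that
  proof induction
    case (prod x j)
    have "x \<otimes> j = x \<otimes> ev j \<oplus> x \<otimes> od j" using prod r_distr[of "ev j" "od j" x] by (simp add: ev_od)
    then have "ev (x \<otimes> j) = ev x \<otimes> ev j \<oplus> od x \<otimes> od j"
      using prod by (simp add: ev_add ev_mult_even ev_mult_odd)
    then show ?case using prod X(2) Xod graded_ideal_ev[OF J] graded_ideal_od[OF J] by (simp add: ideal_prod.intros)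
  next
    case (sum s t)
    then show ?case using carr by (simp add: ev_add ideal_prod.sum)
  qed
  moreover have "a \<otimes> s \<in> X \<cdot> J" if a: "a \<in> carrier R" and s: "s \<in> X \<cdot> J" for a s
  proof -
    have "a \<otimes> s = ev a \<otimes> s \<oplus> od a \<otimes> s" using a carr[OF s] l_distr[of "ev a" "od a" s] by (simp add: ev_od)
    moreover have "ev a \<otimes> s \<in> X \<cdot> J" "od a \<otimes> s \<in> X \<cdot> J" using hom[OF s] a by simp_all
    ultimately show ?thesis using ideal_prod.sum by simp
  qed
  moreover have "additive_subgroup (X \<cdot> J) R"
  proof (rule additive_subgroup_closedI)
    show "\<zero> \<in> X \<cdot> J" using ideal_prod.prod[OF asub_zero[OF X(1)] asub_zero[OF graded_ideal_asub[OF J]], of R] by simp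
    show "\<ominus> s \<in> X \<cdot> J" if "s \<in> X \<cdot> J" for s
      using calculation(2)[of "\<ominus> \<one>" s] that carr[OF that] by (simp add: l_minus)
  qed (use carr ideal_prod.sum in auto)
  ultimately show ?thesis
    using carr by (auto simp: graded_ideal_def)
qed

text \<open>For homogeneous z in K, x z = z x' with x' again in J; a general y is the sum of its two
  components, both in K.\<close>

lemma graded_ideal_mult_commute:
  assumes J: "graded_ideal (carrier R) J" and K: "graded_ideal (carrier R) K" and x: "x \<in> J" and y: "y \<in> K"
  shows "x \<otimes> y \<in> K \<cdot> J"
proof -
  have hom: "x \<otimes> z \<in> K \<cdot> J" if z: "z \<in> K" "z \<in> even_part R \<union> odd_part R" for z
  proof -
    obtain x' where "x' \<in> J" "x \<otimes> z = z \<otimes> x'"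
      using homog_twist(2)[OF graded_ideal_asub[OF J] graded_ideal_ev[OF J] z(2) x] by auto
    then show ?thesis using z ideal_prod.prod[of z K x' J R] by simp
  qed
  have [simp]: "x \<in> carrier R" "y \<in> carrier R"
    using x y J K graded_ideal_sub by blast+
  have "x \<otimes> y = x \<otimes> ev y \<oplus> x \<otimes> od y" using r_distr[of "ev y" "od y" x] by (simp add: ev_od)
  then show ?thesis
    using hom[OF graded_ideal_ev[OF K y]] hom[OF graded_ideal_od[OF K y]] ideal_prod.sum by simp
qed

lemma ideal_prod_subset:
  assumes "additive_subgroup X R" "\<And>i j. \<lbrakk>i \<in> I; j \<in> J\<rbrakk> \<Longrightarrow> i \<otimes> j \<in> X"
  shows "I \<cdot> J \<subseteq> X"
proof
  fix s assume "s \<in> I \<cdot> J"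
  then show "s \<in> X" by induction (use assms asub_add in auto)
qed

text \<open>Together with \<open>ideal_prod_subset\<close> and \<open>lspan_subset\<close>, this
  lets a claim about products with all elements of an ideal product or span be checked on single
  products only.\<close>

lemma asub_vimage_mult_l:
  assumes X: "additive_subgroup X R" and a: "a \<in> carrier R"
  shows "additive_subgroup {s \<in> carrier R. a \<otimes> s \<in> X} R"
  by (rule additive_subgroup_closedI)
    (use a asub_zero[OF X] asub_add[OF X] asub_neg[OF X] in \<open>auto simp: r_distr r_minus\<close>)

lemma asub_vimage_mult_r:
  assumes X: "additive_subgroup X R" and a: "a \<in> carrier R"
  shows "additive_subgroup {s \<in> carrier R. s \<otimes> a \<in> X} R"
  by (rule additive_subgroup_closedI)
    (use a asub_zero[OF X] asub_add[OF X] asub_neg[OF X] in \<open>auto simp: l_distr l_minus\<close>)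

lemma lspan_subset:
  assumes "additive_subgroup X R" "\<And>r y. \<lbrakk>r \<in> carrier R; y \<in> Y\<rbrakk> \<Longrightarrow> r \<otimes> y \<in> X"
  shows "lspan Y \<subseteq> X"
proof
  fix s assume "s \<in> lspan Y"
  then show "s \<in> X" by induction (use assms asub_add asub_zero in auto)
qed

context
  fixes I
  assumes noeth: "noetherian_super_ring R" and dim: "ksdim0 R < \<infinity>" and I: "graded_ideal (carrier R) I"
begin

lemma ideal_carr [simp]: "x \<in> I \<Longrightarrow> x \<in> carrier R"
  using graded_ideal_sub[OF I] by blast

section \<open>The graded ring of the powers of I\<close>

abbreviation pow_I :: "nat \<Rightarrow> 'a set"
  where "pow_I n \<equiv> I [^]\<^bsub>ideals_set R\<^esub> n"

lemma pow_I_0: "pow_I 0 = carrier R"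
  and pow_I_Suc: "pow_I (Suc n) = pow_I n \<cdot> I"
  by (simp_all add: nat_pow_def ideals_set_def)

lemma graded_ideal_carrier: "graded_ideal (carrier R) (carrier R)"
  unfolding graded_ideal_def using subsuper_ring_asub[OF subsuper_ring_carrier] by auto

lemma graded_ideal_pow: "graded_ideal (carrier R) (pow_I n)"
proof (induction n)
  case 0
  show ?case unfolding pow_I_0 by (rule graded_ideal_carrier)
next
  case (Suc n)
  show ?case unfolding pow_I_Suc
    by (rule graded_ideal_ideal_prod[OF graded_ideal_asub[OF Suc] graded_ideal_ev[OF Suc] I])
qed

lemma pow_I_carr: "x \<in> pow_I n \<Longrightarrow> x \<in> carrier R"
  using graded_ideal_sub[OF graded_ideal_pow] by blast

text \<open>Powers grow by a factor I on the right, so the induction is on the second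
  exponent.\<close>

lemma pow_I_mult:
  assumes a: "a \<in> pow_I i"
  shows "b \<in> pow_I j \<Longrightarrow> a \<otimes> b \<in> pow_I (i + j)"
proof (induction j arbitrary: b)
  case 0
  then show ?case using graded_ideal_r[OF graded_ideal_pow subsuper_ring_carrier _ a] by (simp only: pow_I_0 add_0_right)
next
  case (Suc j)
  have "pow_I j \<cdot> I \<subseteq> {s \<in> carrier R. a \<otimes> s \<in> pow_I (i + Suc j)}"
  proof (rule ideal_prod_subset[OF asub_vimage_mult_l[OF graded_ideal_asub[OF graded_ideal_pow] pow_I_carr[OF a]]])
    fix b x assume b: "b \<in> pow_I j" and x: "x \<in> I"
    have "(a \<otimes> b) \<otimes> x \<in> pow_I (i + Suc j)"
      unfolding add_Suc_right pow_I_Suc using Suc.IH[OF b] x by (rule ideal_prod.prod)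
    then show "b \<otimes> x \<in> {s \<in> carrier R. a \<otimes> s \<in> pow_I (i + Suc j)}"
      using pow_I_carr[OF a] pow_I_carr[OF b] x by (simp add: m_assoc)
  qed
  then show ?case using Suc.prems unfolding pow_I_Suc[of j] by blast
qed

lemma pow_I_Suc_subset: "pow_I (Suc n) \<subseteq> pow_I n"
  unfolding pow_I_Suc
  by (rule ideal_prod_subset[OF graded_ideal_asub[OF graded_ideal_pow]])
    (use graded_ideal_r[OF graded_ideal_pow subsuper_ring_carrier] in auto)

lemma finite_nat_pairs: "finite {(i, j). i + j = (n::nat)}"
  by (rule finite_subset[of _ "{..n} \<times> {..n}"]) auto

lemma graded_family_gr: "graded_family R pow_I (\<lambda>n. pow_I (Suc n))"
proof (intro graded_family.intro graded_family_axioms.intro super_ring_axioms graded_ideal_pow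
    finite_nat_pairs pow_I_Suc_subset pow_I_0)
  show "a \<otimes> b \<in> pow_I (i + j)" if "a \<in> pow_I i" "b \<in> pow_I j" for a b i j
    using pow_I_mult that by blast
  show "a \<otimes> b \<in> pow_I (Suc (i + j))" if "a \<in> pow_I i" "b \<in> pow_I (Suc j)" for a b i j
    using pow_I_mult[OF that] by simp
  show "a \<otimes> b \<in> pow_I (Suc (i + j))" if "a \<in> pow_I (Suc i)" "b \<in> pow_I j" for a b i j
    using pow_I_mult[OF that] by simp
qed

lemma homogeneous_generators:
  assumes "X \<subseteq> even_part R \<union> odd_part R"
  obtains Y where "finite Y" "Y \<subseteq> X" "X \<subseteq> lspan Y"
  using finitely_generated[OF _ assms] noeth noetherian_iff by blast

lemma gr_noetherian: "noetherian_super_ring (gr R I) \<and> ksdim0 (gr R I) < \<infinity>"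
proof -
  interpret graded_family R pow_I "\<lambda>n. pow_I (Suc n)" by (rule graded_family_gr)
  obtain Y where Y: "finite Y" "Y \<subseteq> I \<inter> (even_part R \<union> odd_part R)"
    "I \<inter> (even_part R \<union> odd_part R) \<subseteq> lspan Y"
    using homogeneous_generators[of "I \<inter> (even_part R \<union> odd_part R)"] by blast
  have Ya: "additive_subgroup (lspan Y) R" using lspan_graded_ideal[of Y] graded_ideal_asub Y(2) by blast
  have IY: "I \<subseteq> lspan Y"
  proof
    fix x assume x: "x \<in> I"
    then have "ev x \<in> lspan Y" "od x \<in> lspan Y" using Y(3) graded_ideal_ev[OF I] graded_ideal_od[OF I] by auto
    then show "x \<in> lspan Y" using asub_add[OF Ya, of "ev x" "od x"] x by (simp add: ev_od)
  qed
  have "noetherian_super_ring S \<and> ksdim0 S < \<infinity>"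
  proof (rule finitely_generated_noeth_findim[OF noeth dim, of "{1} \<times> Y"])
    fix i :: nat and z assume "(i, z) \<in> {1} \<times> Y"
    then have z: "i = Suc 0" "z \<in> I" "z \<in> even_part R \<union> odd_part R" using Y(2) by auto
    \<comment> \<open>The first power is by definition the product of \<open>carrier R\<close> and
      I, so z is exhibited as a product with \<one>.\<close>
    have "\<one> \<otimes> z \<in> pow_I (Suc 0)"
      unfolding pow_I_Suc pow_I_0 using one_closed z(2) by (rule ideal_prod.prod)
    then show "z \<in> pow_I i \<and> z \<in> even_part R \<union> odd_part R" using z by simp
  next
    fix H :: "nat \<Rightarrow> 'a set" and i
    assume H: "\<And>i. additive_subgroup (H i) R" "H 0 = carrier R" "\<And>i z. (i, z) \<in> {1} \<times> Y \<Longrightarrow> z \<in> H i"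
      "\<And>i j x y. \<lbrakk>x \<in> H i; y \<in> H j\<rbrakk> \<Longrightarrow> x \<otimes> y \<in> H (i + j)"
    show "pow_I i \<subseteq> H i"
    proof (induction i)
      case 0
      show ?case unfolding pow_I_0 H(2) ..
    next
      case (Suc n)
      show ?case unfolding pow_I_Suc
      proof (rule ideal_prod_subset[OF H(1)])
        fix a b assume a: "a \<in> pow_I n" and b: "b \<in> I"
        \<comment> \<open>In a (r y) the coefficient r is absorbed on the left: a r is again in the
          n-th power of I, a two-sided ideal, and only y contributes the extra degree.\<close>
        have "lspan Y \<subseteq> {s \<in> carrier R. a \<otimes> s \<in> H (Suc n)}"
        proof (rule lspan_subset[OF asub_vimage_mult_l[OF H(1) pow_I_carr[OF a]]])
          fix r y assume r: "r \<in> carrier R" and y: "y \<in> Y"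
          have "a \<otimes> r \<in> H n" using graded_ideal_r[OF graded_ideal_pow subsuper_ring_carrier r a] Suc by blast
          then have "(a \<otimes> r) \<otimes> y \<in> H (n + 1)" by (rule H(4)) (use y H(3) in auto)
          moreover have "y \<in> carrier R" using y Y(2) by auto
          ultimately show "r \<otimes> y \<in> {s \<in> carrier R. a \<otimes> s \<in> H (Suc n)}"
            using r pow_I_carr[OF a] by (simp add: m_assoc)
        qed
        then show "a \<otimes> b \<in> H (Suc n)" using b IY by blast
      qed
    qed
  qed (use Y(1) in simp)
  then show ?thesis by (simp only: gr_def)
qed

section \<open>The bigraded ring of the mixed powers\<close>

abbreviation bip :: "nat \<Rightarrow> nat \<Rightarrow> 'a set"
  where "bip \<equiv> bipower R I"

lemma bip_0_0: "bip 0 0 = carrier R"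
  and bip_0_Suc: "bip 0 (Suc l) = (I \<inter> odd_part R) \<cdot> bip 0 l"
  and bip_Suc: "bip (Suc k) l = (I \<inter> even_part R) \<cdot> bip k l"
  by (simp_all add: bipower_def)

lemma graded_ideal_bip: "graded_ideal (carrier R) (bip k l)"
proof (induction k)
  case 0
  show ?case
  proof (induction l)
    case 0
    show ?case unfolding bip_0_0 by (rule graded_ideal_carrier)
  next
    case (Suc l)
    show ?case unfolding bip_0_Suc
      by (rule graded_ideal_ideal_prod[OF asub_inter[OF graded_ideal_asub[OF I] odd_asub] _ Suc])
        (use asub_zero[OF graded_ideal_asub[OF I]] in \<open>auto simp: ev_0\<close>)
  qed
next
  case (Suc k)
  show ?case unfolding bip_Suc
    by (rule graded_ideal_ideal_prod[OF asub_inter[OF graded_ideal_asub[OF I] even_asub] _ Suc]) (auto simp: ev_id)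
qed

lemmas bip_asub = graded_ideal_asub[OF graded_ideal_bip]

lemma bip_carr: "x \<in> bip k l \<Longrightarrow> x \<in> carrier R"
  using graded_ideal_sub[OF graded_ideal_bip] by blast

lemma bip_even: "\<lbrakk>x \<in> I; x \<in> even_part R; b \<in> bip k l\<rbrakk> \<Longrightarrow> x \<otimes> b \<in> bip (Suc k) l"
  unfolding bip_Suc by (rule ideal_prod.prod) auto

text \<open>The even factors stand on the left, so y has to pass all k of them to reach the odd
  ones; it does so without a sign, even elements being central.\<close>

lemma bip_odd:
  assumes y: "y \<in> I" "y \<in> odd_part R"
  shows "b \<in> bip k l \<Longrightarrow> y \<otimes> b \<in> bip k (Suc l)"
proof (induction k arbitrary: b)
  case 0
  then show ?case unfolding bip_0_Suc using y by (intro ideal_prod.prod) auto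
next
  case (Suc k)
  have "(I \<inter> even_part R) \<cdot> bip k l \<subseteq> {s \<in> carrier R. y \<otimes> s \<in> bip (Suc k) (Suc l)}"
  proof (rule ideal_prod_subset[OF asub_vimage_mult_l[OF bip_asub]])
    fix x b assume x: "x \<in> I \<inter> even_part R" and b: "b \<in> bip k l"
    have c: "x \<in> carrier R" "b \<in> carrier R" "y \<in> carrier R" using x b bip_carr y by auto
    have "y \<otimes> (x \<otimes> b) = (x \<otimes> y) \<otimes> b" using c even_commute[of x y] x y by (simp add: m_assoc)
    then have "y \<otimes> (x \<otimes> b) = x \<otimes> (y \<otimes> b)" using c by (simp add: m_assoc)
    then show "x \<otimes> b \<in> {s \<in> carrier R. y \<otimes> s \<in> bip (Suc k) (Suc l)}"
      using bip_even[of x] x Suc.IH[OF b] c by simp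
  qed (use y in simp)
  then show ?case using Suc.prems by (auto simp: bip_Suc)
qed

text \<open>The leftmost factor of a is peeled off and put back in front of the product by
  \<open>bip_odd\<close> or \<open>bip_even\<close>.\<close>

lemma bip_mult:
  assumes b: "b \<in> bip k' l'"
  shows "a \<in> bip k l \<Longrightarrow> a \<otimes> b \<in> bip (k + k') (l + l')"
proof (induction k arbitrary: a)
  case 0
  then show ?case
  proof (induction l arbitrary: a)
    case 0
    then show ?case using graded_ideal_l[OF graded_ideal_bip _ b] by (simp add: bip_0_0)
  next
    case (Suc l)
    have "(I \<inter> odd_part R) \<cdot> bip 0 l \<subseteq> {s \<in> carrier R. s \<otimes> b \<in> bip (0 + k') (Suc l + l')}"
    proof (rule ideal_prod_subset[OF asub_vimage_mult_r[OF bip_asub bip_carr[OF b]]])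
      fix y a assume y: "y \<in> I \<inter> odd_part R" and a: "a \<in> bip 0 l"
      show "y \<otimes> a \<in> {s \<in> carrier R. s \<otimes> b \<in> bip (0 + k') (Suc l + l')}"
        using bip_odd[of y "a \<otimes> b"] y Suc.IH[OF a] bip_carr[OF a] bip_carr[OF b] by (simp add: m_assoc)
    qed
    then show ?case using Suc.prems unfolding bip_0_Suc by blast
  qed
next
  case (Suc k)
  have "(I \<inter> even_part R) \<cdot> bip k l \<subseteq> {s \<in> carrier R. s \<otimes> b \<in> bip (Suc k + k') (l + l')}"
  proof (rule ideal_prod_subset[OF asub_vimage_mult_r[OF bip_asub bip_carr[OF b]]])
    fix x a assume x: "x \<in> I \<inter> even_part R" and a: "a \<in> bip k l"
    show "x \<otimes> a \<in> {s \<in> carrier R. s \<otimes> b \<in> bip (Suc k + k') (l + l')}"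
      using bip_even[of x "a \<otimes> b"] x Suc.IH[OF a] bip_carr[OF a] bip_carr[OF b] by (simp add: m_assoc)
  qed
  then show ?case using Suc.prems unfolding bip_Suc by blast
qed

abbreviation bF :: "nat \<times> nat \<Rightarrow> 'a set"
  where "bF \<equiv> \<lambda>(k, l). bip k l"

abbreviation bG :: "nat \<times> nat \<Rightarrow> 'a set"
  where "bG \<equiv> \<lambda>(k, l). I \<cdot> bip k l"

lemma bF_mult: "\<lbrakk>a \<in> bF i; b \<in> bF j\<rbrakk> \<Longrightarrow> a \<otimes> b \<in> bF (i + j)"
  using bip_mult by (cases i; cases j) auto

lemma graded_ideal_bG: "graded_ideal (carrier R) (bG i)"
  using graded_ideal_ideal_prod[OF graded_ideal_asub[OF I] graded_ideal_ev[OF I] graded_ideal_bip] by (cases i) auto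

lemma bG_bF: 
  assumes u: "u \<in> bG i" and c: "c \<in> bF j"
  shows "u \<otimes> c \<in> bG (i + j)"
proof -
  have cc: "c \<in> carrier R" using c bip_carr by (cases j) auto
  have "I \<cdot> bF i \<subseteq> {s \<in> carrier R. s \<otimes> c \<in> bG (i + j)}"
  proof (rule ideal_prod_subset[OF asub_vimage_mult_r[OF graded_ideal_asub[OF graded_ideal_bG] cc]])
    fix x a assume x: "x \<in> I" and a: "a \<in> bF i"
    have ac: "a \<in> carrier R" using a bip_carr by (cases i) auto
    have "x \<otimes> (a \<otimes> c) \<in> I \<cdot> bF (i + j)" using x bF_mult[OF a c] by (rule ideal_prod.prod)
    then show "x \<otimes> a \<in> {s \<in> carrier R. s \<otimes> c \<in> bG (i + j)}"
      using x ac cc by (simp add: m_assoc case_prod_unfold)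
  qed
  then show ?thesis using u by (auto simp: case_prod_unfold)
qed

text \<open>The factor from I stands in the middle of a (x c). Since a x lies in I times the ideal
  of a, by \<open>graded_ideal_mult_commute\<close>, the claim reduces to the other side.\<close>

lemma bF_bG: 
  assumes a: "a \<in> bF i" and u: "u \<in> bG j"
  shows "a \<otimes> u \<in> bG (i + j)"
proof -
  have ac: "a \<in> carrier R" using a bip_carr by (cases i) auto
  have "I \<cdot> bF j \<subseteq> {s \<in> carrier R. a \<otimes> s \<in> bG (i + j)}"
  proof (rule ideal_prod_subset[OF asub_vimage_mult_l[OF graded_ideal_asub[OF graded_ideal_bG] ac]])
    fix x c assume x: "x \<in> I" and c: "c \<in> bF j"
    have cc: "c \<in> carrier R" using c bip_carr by (cases j) auto
    have "a \<otimes> x \<in> bG i"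
      using graded_ideal_mult_commute[OF graded_ideal_bip I _ x] a by (cases i) auto
    then have "(a \<otimes> x) \<otimes> c \<in> bG (i + j)" using c by (rule bG_bF)
    then show "x \<otimes> c \<in> {s \<in> carrier R. a \<otimes> s \<in> bG (i + j)}"
      using x ac cc by (simp add: m_assoc)
  qed
  then show ?thesis using u by (auto simp: case_prod_unfold)
qed

lemma finite_nat_pair_pairs: "finite {(i, j). i + j = (n::nat \<times> nat)}"
proof (rule finite_subset)
  show "{(i, j). i + j = n} \<subseteq> ({..fst n} \<times> {..snd n}) \<times> ({..fst n} \<times> {..snd n})" by auto
qed simp

lemma graded_family_bgr: "graded_family R bF bG"
proof (intro graded_family.intro graded_family_axioms.intro super_ring_axioms graded_ideal_bG
    finite_nat_pair_pairs bF_mult)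
  show "a \<otimes> b \<in> bG (i + j)" if "a \<in> bF i" "b \<in> bG j" for a b i j
    using that by (rule bF_bG)
  show "a \<otimes> b \<in> bG (i + j)" if "a \<in> bG i" "b \<in> bF j" for a b i j
    using that by (rule bG_bF)
  fix i :: "nat \<times> nat"
  show "graded_ideal (carrier R) (bF i)" using graded_ideal_bip by (cases i) auto
  show "bG i \<subseteq> bF i"
  proof -
    have "I \<cdot> bip k l \<subseteq> bip k l" for k l
      by (rule ideal_prod_subset[OF bip_asub]) (use graded_ideal_l[OF graded_ideal_bip] in auto)
    then show ?thesis by (cases i) auto
  qed
  show "bF 0 = carrier R" by (simp add: zero_prod_def bip_0_0)
qed

text \<open>Here the generator must come first: r y = y r' for homogeneous y, so (r y) c = y (r' c),
  and r' c stays in the ideal J.\<close>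

lemma lspan_mult:
  assumes Y: "Y \<subseteq> even_part R \<union> odd_part R" and c: "c \<in> J" and J: "graded_ideal (carrier R) J"
    and X: "additive_subgroup X R" and gen: "\<And>y c. \<lbrakk>y \<in> Y; c \<in> J\<rbrakk> \<Longrightarrow> y \<otimes> c \<in> X" and b: "b \<in> lspan Y"
  shows "b \<otimes> c \<in> X"
proof -
  have cc: "c \<in> carrier R" using c graded_ideal_sub[OF J] by blast
  have "lspan Y \<subseteq> {s \<in> carrier R. s \<otimes> c \<in> X}"
  proof (rule lspan_subset[OF asub_vimage_mult_r[OF X cc]])
    fix r y assume r: "r \<in> carrier R" and y: "y \<in> Y"
    have yc: "y \<in> even_part R \<union> odd_part R" "y \<in> carrier R" using y Y by auto
    obtain r' where r': "r' \<in> carrier R" "r \<otimes> y = y \<otimes> r'"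
      using homog_twist(2)[OF subsuper_ring_asub[OF subsuper_ring_carrier] subsuper_ring_ev[OF subsuper_ring_carrier] yc(1) r]
      by blast
    have "y \<otimes> (r' \<otimes> c) \<in> X" using gen[OF y] graded_ideal_l[OF J r'(1) c] by blast
    then show "r \<otimes> y \<in> {s \<in> carrier R. s \<otimes> c \<in> X}"
      using r r' yc cc by (simp add: m_assoc)
  qed
  then show ?thesis using b by blast
qed

lemma bgr_noetherian: "noetherian_super_ring (bgr R I) \<and> ksdim0 (bgr R I) < \<infinity>"
proof -
  interpret graded_family R bF bG by (rule graded_family_bgr)
  \<comment> \<open>Even and odd elements of I are generated separately, since they get the
    different degrees (1, 0) and (0, 1). Coefficients are taken from all of R.\<close>
  obtain Y0 where Y0: "finite Y0" "Y0 \<subseteq> I \<inter> even_part R" "I \<inter> even_part R \<subseteq> lspan Y0"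
    using homogeneous_generators[of "I \<inter> even_part R"] by blast
  obtain Y1 where Y1: "finite Y1" "Y1 \<subseteq> I \<inter> odd_part R" "I \<inter> odd_part R \<subseteq> lspan Y1"
    using homogeneous_generators[of "I \<inter> odd_part R"] by blast
  let ?Z = "{(1, 0)} \<times> Y0 \<union> {(0, 1)} \<times> Y1"
  have "noetherian_super_ring S \<and> ksdim0 S < \<infinity>"
  proof (rule finitely_generated_noeth_findim[OF noeth dim, of ?Z])
    fix i :: "nat \<times> nat" and z assume "(i, z) \<in> ?Z"
    then consider "i = (Suc 0, 0)" "z \<in> I" "z \<in> even_part R" | "i = (0, Suc 0)" "z \<in> I" "z \<in> odd_part R"
      using Y0(2) Y1(2) by auto
    then show "z \<in> bF i \<and> z \<in> even_part R \<union> odd_part R"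
      using bip_even[of z \<one> 0 0] bip_odd[of z \<one> 0 0] by cases (simp_all add: bip_0_0)
  next
    fix H :: "nat \<times> nat \<Rightarrow> 'a set" and i
    assume H: "\<And>i. additive_subgroup (H i) R" "H 0 = carrier R" "\<And>i z. (i, z) \<in> ?Z \<Longrightarrow> z \<in> H i"
      "\<And>i j x y. \<lbrakk>x \<in> H i; y \<in> H j\<rbrakk> \<Longrightarrow> x \<otimes> y \<in> H (i + j)"
    have "bip k l \<subseteq> H (k, l)" for k l
    proof (induction k)
      case 0
      show ?case
      proof (induction l)
        case 0
        show ?case using H(2) by (simp add: bip_0_0 zero_prod_def)
      next
        case (Suc l)
        show ?case unfolding bip_0_Suc
        proof (rule ideal_prod_subset[OF H(1)])
          fix b c assume b: "b \<in> I \<inter> odd_part R" and c: "c \<in> bip 0 l"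
          show "b \<otimes> c \<in> H (0, Suc l)"
          proof (rule lspan_mult[OF _ c graded_ideal_bip H(1)])
            show "y \<otimes> c \<in> H (0, Suc l)" if "y \<in> Y1" "c \<in> bip 0 l" for y c
              using H(4)[of y "(0, 1)" c "(0, l)"] H(3)[of "(0, 1)" y] that Suc by auto
          qed (use b Y1 in auto)
        qed
      qed
    next
      case (Suc k)
      show ?case unfolding bip_Suc
      proof (rule ideal_prod_subset[OF H(1)])
        fix b c assume b: "b \<in> I \<inter> even_part R" and c: "c \<in> bip k l"
        show "b \<otimes> c \<in> H (Suc k, l)"
        proof (rule lspan_mult[OF _ c graded_ideal_bip H(1)])
          show "y \<otimes> c \<in> H (Suc k, l)" if "y \<in> Y0" "c \<in> bip k l" for y c
            using H(4)[of y "(1, 0)" c "(k, l)"] H(3)[of "(1, 0)" y] that Suc by auto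
        qed (use b Y0 in auto)
      qed
    qed
    then show "bF i \<subseteq> H i" by (cases i) auto
  qed (use Y0(1) Y1(1) in simp)
  then show ?thesis by (simp only: bgr_def)
qed

end

end

theorem lemma4p1:
  fixes R :: "('a, 'm) super_ring_scheme" and I :: "'a set"
  assumes "noetherian_super_ring R"
    and "krull_dim (even_subring R) < \<infinity>"
    and "superideal I R"
  shows "noetherian_super_ring (gr R I) \<and> noetherian_super_ring (bgr R I)
    \<and> ksdim0 (gr R I) < \<infinity> \<and> ksdim0 (bgr R I) < \<infinity>"
proof -
  interpret super_ring R using assms(1) by (simp add: noetherian_super_ring_def)
  have "ksdim0 R < \<infinity>" "graded_ideal (carrier R) I"
    using assms(2,3) by (simp_all add: ksdim0_def superideal_iff)
  then show ?thesis using gr_noetherian bgr_noetherian assms(1) by blast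
qed

end
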